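(* Let $\mathbf{K}$ be an infinite field with a non-trivial non-archimedean valuation and let $m\ge2$ be an integer. There exists a discontinuous function $f:\mathbf{K}^m\to\mathbf{K}$ such that $f\circ u\in C^\infty(\mathbf{K}^{m-1},\mathbf{K})$ for each locally analytic function $u:\mathbf{K}^{m-1}\to\mathbf{K}^m$.
   Context: The valuation $|\cdot|$ on $\mathbf{K}$ is real-valued, multiplicative and satisfies $|x+y|\le\max(|x|,|y|)$; $\mathbf{K}^d$ carries the max norm. A function is locally analytic if near each point of its domain it is given by a convergent power series. Spaces $C^n$. Put $X=\mathbf{K}^d$, $Y=\mathbf{K}^l$. For $n\ge1$ let $X^{(n)}=X^{n+1}\times\mathbf{K}^n$ with points $(x;v_1,\dots,v_n;t_1,\dots,t_n)$. For $f:X\to Y$ put $\Phi^1f(x;v;t)=(f(x+tv)-f(x))/t$ for $t\neq0$ and, for $t_1,\dots,t_{n+1}\ne0$, $$\Phi^{n+1}f(x;v_1,\dots,v_{n+1};t_1,\dots,t_{n+1})=\Phi^1\big(\Phi^nf(\,\cdot\,;v_1,\dots,v_n;t_1,\dots,t_n)\big)(x;v_{n+1};t_{n+1}).$$ $f\in C^n(X,Y)$ if $f$ is continuous and each $\Phi^kf$, $k=1,\dots,n$, has a continuous extension $\bar\Phi^kf$ to $X^{(k)}$. $C^\infty=\bigcap_{n\ge 0}C^n$, where $C^0$ is the space of continuous functions. *)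

theory Defs
  imports "HOL-Analysis.Analysis"
begin

text \<open>The valuation induces the metric, so the topological notions of the library
  (\<^const>\<open>continuous_on\<close>, \<^const>\<open>has_sum\<close>) refer to the valuation topology. Completeness is not assumed,
  and the trivial valuation is allowed.\<close>

class nonarch_valued_field = field + metric_space +
  fixes vabs :: "'a \<Rightarrow> real"
  assumes vabs_nonneg: "0 \<le> vabs x"
    and vabs_eq_0_iff: "vabs x = 0 \<longleftrightarrow> x = 0"
    and vabs_mult: "vabs (x * y) = vabs x * vabs y"
    and vabs_add_le_max: "vabs (x + y) \<le> max (vabs x) (vabs y)"
    and dist_vabs: "dist x y = vabs (x - y)"
begin

lemma vabs_one: "vabs 1 = 1"
  using vabs_mult[of 1 1] vabs_eq_0_iff[of 1] by simp

lemma vabs_minus: "vabs (- x) = vabs x"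
proof -
  have "vabs (- 1) * vabs (- 1) = 1"
    using vabs_mult[of "- 1" "- 1"] vabs_one by simp
  then have "vabs (- 1) = 1"
    using vabs_nonneg[of "- 1"] by (metis abs_of_nonneg abs_mult_self_eq real_sqrt_abs2 real_sqrt_one)
  then show ?thesis
    using vabs_mult[of "- 1" x] by simp
qed

lemma vabs_triangle: "vabs (x + y) \<le> vabs x + vabs y"
  using vabs_add_le_max[of x y] vabs_nonneg[of x] vabs_nonneg[of y] by simp

end

instance nonarch_valued_field \<subseteq> topological_ab_group_add
proof
  fix a b :: 'a
  show "((\<lambda>x. fst x + snd x) \<longlongrightarrow> a + b) (nhds a \<times>\<^sub>F nhds b)"
  proof (rule tendstoI)
    fix e :: real assume e: "0 < e"
    have "\<forall>\<^sub>F x in nhds a. dist x a < e / 2" "\<forall>\<^sub>F y in nhds b. dist y b < e / 2"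
      using e by (auto simp: eventually_nhds_metric intro: exI[of _ "e / 2"])
    then have "\<forall>\<^sub>F z in nhds a \<times>\<^sub>F nhds b. dist (fst z) a < e / 2 \<and> dist (snd z) b < e / 2"
      by (rule eventually_prodI)
    then show "\<forall>\<^sub>F z in nhds a \<times>\<^sub>F nhds b. dist (fst z + snd z) (a + b) < e"
    proof (rule eventually_mono)
      fix z :: "'a \<times> 'a"
      assume "dist (fst z) a < e / 2 \<and> dist (snd z) b < e / 2"
      then show "dist (fst z + snd z) (a + b) < e"
        using vabs_triangle[of "fst z - a" "snd z - b"]
        by (simp add: dist_vabs add_diff_add)
    qed
  qed
  show "(uminus \<longlongrightarrow> - a) (nhds a)"
  proof (rule tendstoI)
    fix e :: real assume "0 < e"
    moreover have "dist (- x) (- a) = dist x a" for x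
      using vabs_minus[of "x - a"] by (simp add: dist_vabs)
    ultimately show "\<forall>\<^sub>F x in nhds a. dist (- x) (- a) < e"
      by (auto simp: eventually_nhds_metric)
  qed
qed

text \<open>A point of \<open>K\<^sup>d\<close> is a sequence vanishing from index \<open>d\<close> on; the product topology
  of \<^typ>\<open>nat \<Rightarrow> 'k\<close> restricted to these sequences is the topology of the max norm.\<close>

definition Kpow :: "nat \<Rightarrow> (nat \<Rightarrow> 'k::nonarch_valued_field) set" where
  "Kpow d = {x. \<forall>i\<ge>d. x i = 0}"

definition multi_indices :: "nat \<Rightarrow> (nat \<Rightarrow> nat) set" where
  "multi_indices d = {\<alpha>. \<forall>i\<ge>d. \<alpha> i = 0}"

text \<open>The condition \<open>\<forall>i<d. vabs (h i) < r\<close> says that the max norm of \<open>h\<close> is less than \<open>r\<close>.\<close>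

definition locally_analytic ::
  "nat \<Rightarrow> nat \<Rightarrow> ((nat \<Rightarrow> 'k::nonarch_valued_field) \<Rightarrow> (nat \<Rightarrow> 'k)) \<Rightarrow> bool" where
  "locally_analytic d l u \<longleftrightarrow>
     u \<in> Kpow d \<rightarrow> Kpow l \<and>
     (\<forall>a\<in>Kpow d. \<exists>r>0. \<exists>c :: nat \<Rightarrow> (nat \<Rightarrow> nat) \<Rightarrow> 'k.
        \<forall>h\<in>Kpow d. (\<forall>i<d. vabs (h i) < r) \<longrightarrow>
          (\<forall>j<l. ((\<lambda>\<alpha>. c j \<alpha> * (\<Prod>i<d. h i ^ \<alpha> i)) has_sum u (\<lambda>i. a i + h i) j)
                   (multi_indices d)))"

definition diff_quot ::
  "((nat \<Rightarrow> 'k::nonarch_valued_field) \<Rightarrow> 'k) \<Rightarrow> (nat \<Rightarrow> 'k) \<Rightarrow> (nat \<Rightarrow> 'k) \<Rightarrow> 'k \<Rightarrow> 'k" where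
  "diff_quot f x v t = (f (\<lambda>i. x i + t * v i) - f x) / t"

text \<open>The directions and increments are numbered from 0; \<open>Phi n\<close> uses only
  \<open>v 0, \<dots>, v (n - 1)\<close> and \<open>t 0, \<dots>, t (n - 1)\<close>.\<close>

primrec Phi ::
  "nat \<Rightarrow> ((nat \<Rightarrow> 'k::nonarch_valued_field) \<Rightarrow> 'k) \<Rightarrow>
   (nat \<Rightarrow> 'k) \<Rightarrow> (nat \<Rightarrow> nat \<Rightarrow> 'k) \<Rightarrow> (nat \<Rightarrow> 'k) \<Rightarrow> 'k" where
  "Phi 0 f x v t = f x"
| "Phi (Suc n) f x v t = diff_quot (\<lambda>y. Phi n f y v t) x (v n) (t n)"

text \<open>\<open>X\<^sup>(\<^sup>n\<^sup>) = X\<^sup>n\<^sup>+\<^sup>1 \<times> K\<^sup>n\<close> for \<open>X = K\<^sup>d\<close>, the unused entries of \<open>v\<close> and \<open>t\<close> being zero.\<close>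

definition Xn ::
  "nat \<Rightarrow> nat \<Rightarrow> ((nat \<Rightarrow> 'k::nonarch_valued_field) \<times> (nat \<Rightarrow> nat \<Rightarrow> 'k) \<times> (nat \<Rightarrow> 'k)) set" where
  "Xn d n = Kpow d \<times> {v. (\<forall>i<n. v i \<in> Kpow d) \<and> (\<forall>i\<ge>n. v i = (\<lambda>_. 0))} \<times> Kpow n"

text \<open>\<open>C\<^sup>n(K\<^sup>d, K)\<close> and \<open>C\<^sup>\<infinity>(K\<^sup>d, K)\<close>; values of \<open>f\<close> outside \<open>K\<^sup>d\<close> are irrelevant.\<close>

definition C_space :: "nat \<Rightarrow> nat \<Rightarrow> ((nat \<Rightarrow> 'k::nonarch_valued_field) \<Rightarrow> 'k) set" where
  "C_space n d =
     {f. continuous_on (Kpow d) f \<and>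
         (\<forall>k\<in>{1..n}. \<exists>g. continuous_on (Xn d k) g \<and>
            (\<forall>(x, v, t)\<in>Xn d k. (\<forall>i<k. t i \<noteq> 0) \<longrightarrow> g (x, v, t) = Phi k f x v t))}"

definition C_infinity :: "nat \<Rightarrow> ((nat \<Rightarrow> 'k::nonarch_valued_field) \<Rightarrow> 'k) set" where
  "C_infinity d = (\<Inter>n. C_space n d)"

end

theory Submission
  imports Defs "HOL-Library.Function_Algebras" "HOL-Computational_Algebra.Formal_Power_Series"
    "Jordan_Normal_Form.Char_Poly"
begin

text \<open>The function is the indicator of the set of all \<open>x\<close> such that, for some \<open>n \<ge> 1\<close>,
  \<open>|x\<^sub>j| = |p| ^ (n ^ (j + 1))\<close> for all \<open>j < m\<close>, where \<open>0 < |p| < 1\<close>. Away from the origin it is locally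
  constant, but these points accumulate at \<open>0\<close>. Along them \<open>|x\<^sub>0|, \<dots>, |x\<^sub>m\<^sub>-\<^sub>1|\<close> are \<open>m\<close> different scales:
  each is an arbitrarily high power of the previous one. By a quantitative form of Abhyankar's
  inequality (the rank of a valuation is at most the dimension), \<open>m\<close> analytic functions of \<open>m - 1\<close>
  variables vanishing at a point \<open>a\<close> cannot realise such scales arbitrarily close to \<open>a\<close>. Hence the
  composition with a locally analytic map is locally constant, and so \<open>C\<^sup>\<infinity>\<close>.

  Abhyankar's inequality is proved by induction on the number of variables: Weierstrass division by
  the last series makes the others integral over the series in one variable less, and each of them
  has the same scale as some coefficient of its integral equation.\<close>

text \<open>Abhyankar's inequality concerns one valuation, whereas here a whole ball of points
  \<open>h\<close> must be excluded by one exponent \<open>N\<close>. This is possible because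
  evaluation at \<open>h\<close> is a multiplicative seminorm and the integral equations do not
  depend on \<open>h\<close>. Only the coefficient selected in each equation does, and there are
  finitely many selections, so the exponents supplied by the induction hypothesis have a maximum. A
  coefficient selected for a series of size \<open>t\<close> has size between \<open>t ^ K\<close>
  and \<open>t\<close>, where \<open>K\<close> is the degree of the equation; widely spaced sizes
  thus remain widely spaced, at the price of a larger \<open>N\<close>.

  Without completeness, a part of a convergent series need not converge. All algebra is therefore
  done on formal series graded by total degree with coefficients in the valuation ring: Weierstrass
  division becomes a recursion on coefficients without limits, and one rescaling of the variables
  turns a convergent expansion, up to its constant term, into such a series.\<close>

lemma sum_fun_apply: "(\<Sum>i\<in>A. f i) x = (\<Sum>i\<in>A. f i x)"
  by (induction A rule: infinite_finite_induct) simp_all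

section \<open>Ultrametric preliminaries\<close>

lemma vabs_0 [simp]: "vabs (0::'k::nonarch_valued_field) = 0"
  by (simp add: vabs_eq_0_iff)

lemma vabs_1 [simp]: "vabs (1::'k::nonarch_valued_field) = 1"
  by (rule vabs_one)

lemma vabs_pos_iff: "0 < vabs (x::'k::nonarch_valued_field) \<longleftrightarrow> x \<noteq> 0"
  using vabs_nonneg[of x] vabs_eq_0_iff[of x] by linarith

lemma vabs_power: "vabs ((x::'k::nonarch_valued_field) ^ n) = vabs x ^ n"
  by (induction n) (simp_all add: vabs_mult)

lemma vabs_divide: "vabs ((x::'k::nonarch_valued_field) / y) = vabs x / vabs y"
proof (cases "y = 0")
  case False
  then have "vabs (x / y) * vabs y = vabs x"
    by (simp flip: vabs_mult)
  then show ?thesis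
    using False by (simp add: field_simps vabs_eq_0_iff)
qed simp

lemma vabs_diff_le_max: "vabs ((x::'k::nonarch_valued_field) - y) \<le> max (vabs x) (vabs y)"
  using vabs_add_le_max[of x "- y"] by (simp add: vabs_minus)

lemma vabs_sum_le:
  fixes f :: "'a \<Rightarrow> 'k::nonarch_valued_field"
  assumes "\<And>i. i \<in> A \<Longrightarrow> vabs (f i) \<le> c" and "0 \<le> c"
  shows "vabs (sum f A) \<le> c"
  using assms
proof (induction A rule: infinite_finite_induct)
  case (insert x F)
  then show ?case
    using vabs_add_le_max[of "f x" "sum f F"] by (auto intro: order_trans)
qed simp_all

lemma vabs_eq_of_near:
  assumes "vabs ((x::'k::nonarch_valued_field) - y) < vabs y"
  shows "vabs x = vabs y"
proof (rule antisym)
  show "vabs x \<le> vabs y"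
    using vabs_add_le_max[of "x - y" y] assms by simp
  show "vabs y \<le> vabs x"
    using vabs_diff_le_max[of x "x - y"] assms by (simp add: max_def split: if_splits)
qed

lemma abs_vabs_diff_le: "\<bar>vabs (x::'k::nonarch_valued_field) - vabs y\<bar> \<le> vabs (x - y)"
  using vabs_triangle[of "x - y" y] vabs_triangle[of "y - x" x] vabs_minus[of "x - y"] by simp

lemma exists_small:
  assumes "\<exists>x::'k::nonarch_valued_field. x \<noteq> 0 \<and> vabs x \<noteq> 1" and "0 < e"
  shows "\<exists>y::'k. y \<noteq> 0 \<and> vabs y < e"
proof -
  from assms obtain x :: 'k where x: "x \<noteq> 0" "vabs x \<noteq> 1" by blast
  obtain z :: 'k where z: "z \<noteq> 0" "vabs z < 1"
  proof (cases "vabs x < 1")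
    case False
    then have "vabs (1 / x) < 1"
      using x by (simp add: vabs_divide)
    then show ?thesis
      using that[of "1 / x"] x by simp
  qed (use that x in blast)
  obtain n where "vabs z ^ n < e"
    using real_arch_pow_inv[OF assms(2) z(2)] by blast
  then show ?thesis
    using z by (intro exI[of _ "z ^ n"]) (simp add: vabs_power)
qed

section \<open>Power series with integral coefficients\<close>

text \<open>\<open>hom_fun d j\<close>: the functions on \<open>K\<^sup>d\<close> given by a homogeneous polynomial of degree \<open>j\<close>
  with coefficients in the valuation ring.\<close>

inductive hom_fun :: "nat \<Rightarrow> nat \<Rightarrow> ((nat \<Rightarrow> 'k::nonarch_valued_field) \<Rightarrow> 'k) \<Rightarrow> bool" for d where
  zero: "hom_fun d j 0"
| const: "vabs c \<le> 1 \<Longrightarrow> hom_fun d 0 (\<lambda>_. c)"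
| add: "hom_fun d j f \<Longrightarrow> hom_fun d j g \<Longrightarrow> hom_fun d j (f + g)"
| var_mult: "i < d \<Longrightarrow> hom_fun d j f \<Longrightarrow> hom_fun d (Suc j) (\<lambda>h. h i * f h)"

lemma hom_fun_zero: "hom_fun d j (\<lambda>_. 0)"
  using hom_fun.zero[of d j] by (simp add: zero_fun_def)

lemma hom_fun_one: "hom_fun d 0 1"
  using hom_fun.const[of 1 d] by (simp add: one_fun_def)

lemma hom_fun_scale:
  assumes "vabs c \<le> 1" and "hom_fun d j f"
  shows "hom_fun d j (\<lambda>h. c * f h)"
  using assms(2)
proof (induction rule: hom_fun.induct)
  case (zero j)
  show ?case using hom_fun.zero[of d j] by (simp add: zero_fun_def)
next
  case (const b)
  then have "vabs (c * b) \<le> 1"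
    using assms(1) by (simp add: vabs_mult mult_le_one vabs_nonneg)
  then show ?case by (rule hom_fun.const)
next
  case (add j f g)
  then show ?case using hom_fun.add[OF add.IH] by (simp add: plus_fun_def distrib_left)
next
  case (var_mult i j f)
  then show ?case using hom_fun.var_mult[OF var_mult(1,3)] by (simp add: mult.left_commute)
qed

lemma hom_fun_uminus: "hom_fun d j f \<Longrightarrow> hom_fun d j (- f)"
  using hom_fun_scale[of "- 1" d j f] by (simp add: vabs_minus fun_Compl_def)

lemma hom_fun_diff: "hom_fun d j f \<Longrightarrow> hom_fun d j g \<Longrightarrow> hom_fun d j (f - g)"
  using hom_fun.add[OF _ hom_fun_uminus, of d j f g] by simp

lemma hom_fun_sum: "(\<And>i. i \<in> A \<Longrightarrow> hom_fun d j (f i)) \<Longrightarrow> hom_fun d j (sum f A)"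
  by (induction A rule: infinite_finite_induct) (auto intro: hom_fun.zero hom_fun.add)

lemma hom_fun_mult:
  assumes "hom_fun d i f" and "hom_fun d j g"
  shows "hom_fun d (i + j) (f * g)"
  using assms(1)
proof (induction rule: hom_fun.induct)
  case (zero i)
  show ?case by (simp add: zero_fun_def times_fun_def hom_fun_zero)
next
  case (const c)
  then show ?case using hom_fun_scale[OF const assms(2)] by (simp add: times_fun_def)
next
  case (add i f f')
  then show ?case using hom_fun.add[OF add.IH] by (simp only: distrib_right)
next
  case (var_mult l i f)
  then show ?case using hom_fun.var_mult[OF var_mult(1,3)] by (simp add: times_fun_def mult.assoc)
qed

lemma hom_fun_var: "i < d \<Longrightarrow> hom_fun d 1 (\<lambda>h. h i)"
  using hom_fun.var_mult[OF _ hom_fun_one, of i d] by (simp add: one_fun_def)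

lemma hom_fun_power: "hom_fun d i f \<Longrightarrow> hom_fun d (k * i) (f ^ k)"
  by (induction k) (auto simp: hom_fun_one intro: hom_fun_mult)

lemma hom_fun_mono: "hom_fun d j f \<Longrightarrow> d \<le> e \<Longrightarrow> hom_fun e j f"
  by (induction rule: hom_fun.induct) (auto intro: hom_fun.intros)

lemma hom_fun_bound:
  assumes "hom_fun d j f" and "\<forall>i<d. vabs (h i) \<le> r" and "0 \<le> r"
  shows "vabs (f h) \<le> r ^ j"
  using assms(1)
proof (induction rule: hom_fun.induct)
  case (add j f g)
  then show ?case using vabs_add_le_max[of "f h" "g h"] by simp
next
  case (var_mult i j f)
  then show ?case using assms by (simp add: vabs_mult mult_mono vabs_nonneg)
qed (use assms in auto)

lemma hom_fun_subst:
  assumes "hom_fun d j f" and "\<And>i. i < d \<Longrightarrow> hom_fun e 1 (\<lambda>h. L h i)"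
  shows "hom_fun e j (\<lambda>h. f (L h))"
  using assms(1)
proof (induction rule: hom_fun.induct)
  case (zero j)
  show ?case using hom_fun.zero[of e j] by (simp add: zero_fun_def)
next
  case (add j f g)
  then show ?case using hom_fun.add[OF add.IH] by (simp add: plus_fun_def)
next
  case (var_mult i j f)
  then show ?case using hom_fun_mult[OF assms(2) var_mult.IH] by (simp add: times_fun_def)
qed (rule hom_fun.const)

lemma hom_fun_scale_arg: "hom_fun d j f \<Longrightarrow> f (\<lambda>i. c * h i) = c ^ j * f h"
  by (induction rule: hom_fun.induct) (simp_all add: algebra_simps)

lemma hom_fun_cong: "hom_fun d j f \<Longrightarrow> (\<And>i. i < d \<Longrightarrow> h i = h' i) \<Longrightarrow> f h = f h'"
  by (induction rule: hom_fun.induct) simp_all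

text \<open>Forms are known only as functions; restriction to a line makes the finiteness of the
  roots of a one-variable polynomial available for them.\<close>

lemma hom_fun_line_poly: "hom_fun d j f \<Longrightarrow> \<exists>P. \<forall>s. f (\<lambda>i. a i + s * b i) = poly P s"
proof (induction rule: hom_fun.induct)
  case (zero j)
  show ?case by (intro exI[of _ 0]) simp
next
  case (const c)
  show ?case by (intro exI[of _ "[:c:]"]) simp
next
  case (add j f g)
  then obtain P Q where "\<forall>s. f (\<lambda>i. a i + s * b i) = poly P s" "\<forall>s. g (\<lambda>i. a i + s * b i) = poly Q s"
    by blast
  then show ?case by (intro exI[of _ "P + Q"]) simp
next
  case (var_mult i j f)
  then obtain P where "\<forall>s. f (\<lambda>i. a i + s * b i) = poly P s"
    by blast
  then show ?case by (intro exI[of _ "[:a i, b i:] * P"]) (simp add: distrib_right)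
qed

lemma hom_fun_0: "hom_fun 0 j f \<Longrightarrow> \<exists>c. f = (\<lambda>_. c) \<and> (j > 0 \<longrightarrow> c = 0)"
  by (induction rule: hom_fun.induct) (auto simp: zero_fun_def)

lemma hom_fun_degree_0: "hom_fun d 0 f \<Longrightarrow> \<exists>c. f = (\<lambda>_. c) \<and> vabs c \<le> 1"
proof (induction "0::nat" f rule: hom_fun.induct)
  case (add f g)
  then obtain a b where "f = (\<lambda>_. a)" "g = (\<lambda>_. b)" "vabs a \<le> 1" "vabs b \<le> 1" by blast
  then show ?case using vabs_add_le_max[of a b] by (intro exI[of _ "a + b"]) auto
qed (auto simp: zero_fun_def)

lemma hom_fun_split:
  "hom_fun (Suc d) j f \<Longrightarrow>
    \<exists>a. (\<forall>k\<le>j. hom_fun d (j - k) (a k)) \<and> f = (\<lambda>h. \<Sum>k\<le>j. h d ^ k * a k h)"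
proof (induction rule: hom_fun.induct)
  case (zero j)
  show ?case by (intro exI[of _ "\<lambda>_. 0"]) (auto simp: hom_fun_zero zero_fun_def)
next
  case (const c)
  then show ?case by (intro exI[of _ "\<lambda>_ _. c"]) (auto intro: hom_fun.const)
next
  case (add j f g)
  then obtain a b where a: "\<forall>k\<le>j. hom_fun d (j - k) (a k)" "f = (\<lambda>h. \<Sum>k\<le>j. h d ^ k * a k h)"
    and b: "\<forall>k\<le>j. hom_fun d (j - k) (b k)" "g = (\<lambda>h. \<Sum>k\<le>j. h d ^ k * b k h)"
    by blast
  show ?case
    by (intro exI[of _ "\<lambda>k. a k + b k"] conjI allI impI hom_fun.add)
       (use a b in \<open>auto simp: sum.distrib distrib_left\<close>)
next
  case (var_mult i j f)
  then obtain a where a: "\<forall>k\<le>j. hom_fun d (j - k) (a k)" "f = (\<lambda>h. \<Sum>k\<le>j. h d ^ k * a k h)"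
    by blast
  show ?case
  proof (cases "i = d")
    case True
    define b where "b k = (case k of 0 \<Rightarrow> 0 | Suc l \<Rightarrow> a l)" for k
    have "(\<lambda>h. h i * f h) = (\<lambda>h. \<Sum>k\<le>Suc j. h d ^ k * b k h)"
      unfolding sum.atMost_Suc_shift a(2) b_def True
      by (simp add: sum_distrib_left mult.assoc)
    moreover have "\<forall>k\<le>Suc j. hom_fun d (Suc j - k) (b k)"
      using a(1) by (auto simp: b_def hom_fun.zero split: nat.split)
    ultimately show ?thesis by blast
  next
    case False
    then have i: "i < d" using var_mult by simp
    define b where "b k = (if k \<le> j then (\<lambda>h. h i * a k h) else 0)" for k
    have "(\<lambda>h. h i * f h) = (\<lambda>h. \<Sum>k\<le>Suc j. h d ^ k * b k h)"
      unfolding a(2) b_def by (simp add: sum_distrib_left mult.left_commute)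
    moreover have "hom_fun d (Suc j - k) (b k)" if "k \<le> Suc j" for k
      using a(1) hom_fun.var_mult[OF i, of "j - k" "a k"]
      by (auto simp: b_def hom_fun.zero Suc_diff_le)
    ultimately show ?thesis by blast
  qed
qed

text \<open>A series is the formal sum of its homogeneous parts. The coefficient ring of the library's
  formal power series is the ring of \<^emph>\<open>functions\<close> on \<open>K\<^sup>d\<close>, whose ring structure is pointwise.\<close>

type_synonym 'k series = "((nat \<Rightarrow> 'k) \<Rightarrow> 'k) fps"

definition int_series :: "nat \<Rightarrow> 'k::nonarch_valued_field series set" where
  "int_series d = {f. \<forall>j. hom_fun d j (fps_nth f j)}"

lemma int_series_nth: "f \<in> int_series d \<Longrightarrow> hom_fun d j (fps_nth f j)"
  by (simp add: int_series_def)

lemma int_series_0: "0 \<in> int_series d"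
  by (simp add: int_series_def hom_fun.zero)

lemma int_series_const: "vabs c \<le> 1 \<Longrightarrow> fps_const (\<lambda>_. c) \<in> int_series d"
  by (simp add: int_series_def hom_fun.zero hom_fun.const)

lemma int_series_1: "1 \<in> int_series d"
  by (simp add: int_series_def hom_fun.zero hom_fun_one)

lemma int_series_add: "f \<in> int_series d \<Longrightarrow> g \<in> int_series d \<Longrightarrow> f + g \<in> int_series d"
  by (simp add: int_series_def hom_fun.add)

lemma int_series_uminus: "f \<in> int_series d \<Longrightarrow> - f \<in> int_series d"
  by (simp add: int_series_def hom_fun_uminus)

lemma int_series_diff: "f \<in> int_series d \<Longrightarrow> g \<in> int_series d \<Longrightarrow> f - g \<in> int_series d"
  by (simp add: int_series_def hom_fun_diff)

lemma int_series_mult: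
  assumes "f \<in> int_series d" and "g \<in> int_series d"
  shows "f * g \<in> int_series d"
proof -
  have "hom_fun d j (fps_nth f i * fps_nth g (j - i))" if "i \<le> j" for i j
    using hom_fun_mult[of d i "fps_nth f i" "j - i" "fps_nth g (j - i)"] that assms
    by (simp add: int_series_def)
  then show ?thesis
    by (auto simp: int_series_def fps_mult_nth intro!: hom_fun_sum)
qed

lemma int_series_power: "f \<in> int_series d \<Longrightarrow> f ^ n \<in> int_series d"
  by (induction n) (simp_all add: int_series_1 int_series_mult)

lemma int_series_sum: "(\<And>i. i \<in> A \<Longrightarrow> f i \<in> int_series d) \<Longrightarrow> sum f A \<in> int_series d"
  by (induction A rule: infinite_finite_induct) (auto intro: int_series_0 int_series_add)

lemma int_series_mono: "f \<in> int_series d \<Longrightarrow> d \<le> e \<Longrightarrow> f \<in> int_series e"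
  by (auto simp: int_series_def intro: hom_fun_mono)

section \<open>The seminorm of evaluation at a point\<close>

definition trunc :: "'k::nonarch_valued_field series \<Rightarrow> (nat \<Rightarrow> 'k) \<Rightarrow> nat \<Rightarrow> 'k" where
  "trunc f h n = (\<Sum>j<n. fps_nth f j h)"

text \<open>The field need not be complete, so only the absolute value of the sum of the series exists.\<close>

definition eval_norm :: "(nat \<Rightarrow> 'k::nonarch_valued_field) \<Rightarrow> 'k series \<Rightarrow> real" where
  "eval_norm h f = lim (\<lambda>n. vabs (trunc f h n))"

text \<open>On this ball an integral form of degree \<open>j\<close> is at most
  \<open>(1 / 2) ^ j\<close>, which makes the partial sums of an integral series Cauchy.\<close>

definition small :: "nat \<Rightarrow> (nat \<Rightarrow> 'k::nonarch_valued_field) \<Rightarrow> bool" where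
  "small d h \<longleftrightarrow> (\<forall>i<d. vabs (h i) \<le> 1 / 2)"

lemma trunc_diff_le:
  assumes "f \<in> int_series d" and "small d h" and "m \<le> n"
  shows "vabs (trunc f h n - trunc f h m) \<le> (1 / 2) ^ m"
proof -
  have "trunc f h n - trunc f h m = (\<Sum>j\<in>{m..<n}. fps_nth f j h)"
    using assms(3) unfolding trunc_def lessThan_atLeast0
    by (subst sum_diff_nat_ivl) auto
  also have "vabs \<dots> \<le> (1 / 2) ^ m"
  proof (rule vabs_sum_le)
    fix j assume "j \<in> {m..<n}"
    then have "(1 / 2 :: real) ^ j \<le> (1 / 2) ^ m"
      by (intro power_decreasing) auto
    moreover have "vabs (fps_nth f j h) \<le> (1 / 2) ^ j"
      using assms by (intro hom_fun_bound[of d]) (auto simp: int_series_def small_def)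
    ultimately show "vabs (fps_nth f j h) \<le> (1 / 2) ^ m" by (rule order_trans[rotated])
  qed simp
  finally show ?thesis .
qed

lemma trunc_le_1:
  assumes "f \<in> int_series d" and "small d h"
  shows "vabs (trunc f h n) \<le> 1"
  using trunc_diff_le[OF assms, of 0 n] by (simp add: trunc_def)

lemma eval_norm_lim:
  assumes "f \<in> int_series d" and "small d h"
  shows "(\<lambda>n. vabs (trunc f h n)) \<longlonglongrightarrow> eval_norm h f"
proof -
  have "Cauchy (\<lambda>n. vabs (trunc f h n))"
  proof (rule metric_CauchyI)
    fix e :: real assume "0 < e"
    then obtain M where M: "(1 / 2 :: real) ^ M < e"
      using real_arch_pow_inv[of e "1 / 2"] by auto
    have "dist (vabs (trunc f h m)) (vabs (trunc f h n)) < e" if "m \<ge> M" "n \<ge> M" for m n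
    proof -
      have "vabs (trunc f h m - trunc f h n)
          = vabs ((trunc f h m - trunc f h M) - (trunc f h n - trunc f h M))"
        by simp
      also have "\<dots> \<le> (1 / 2) ^ M"
        using vabs_diff_le_max[of "trunc f h m - trunc f h M" "trunc f h n - trunc f h M"]
          trunc_diff_le[OF assms that(1)] trunc_diff_le[OF assms that(2)] by linarith
      finally show ?thesis
        using abs_vabs_diff_le[of "trunc f h m" "trunc f h n"] M by (simp add: dist_real_def)
    qed
    then show "\<exists>M. \<forall>m\<ge>M. \<forall>n\<ge>M. dist (vabs (trunc f h m)) (vabs (trunc f h n)) < e"
      by blast
  qed
  then show ?thesis
    unfolding eval_norm_def by (simp add: Cauchy_convergent convergent_LIMSEQ_iff flip: convergent_LIMSEQ_iff)
qed

lemma eval_norm_nonneg: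
  assumes "f \<in> int_series d" and "small d h"
  shows "0 \<le> eval_norm h f"
  by (rule LIMSEQ_le_const[OF eval_norm_lim[OF assms]]) (auto simp: vabs_nonneg)

lemma eval_norm_le_1:
  assumes "f \<in> int_series d" and "small d h"
  shows "eval_norm h f \<le> 1"
  by (rule LIMSEQ_le_const2[OF eval_norm_lim[OF assms]]) (auto simp: trunc_le_1[OF assms])

lemma eval_norm_const: "eval_norm h (fps_const (\<lambda>_. c)) = vabs c"
proof -
  have "trunc (fps_const (\<lambda>_. c)) h (Suc n) = c" for n
    unfolding trunc_def by (subst sum.lessThan_Suc_shift) simp
  then have "(\<lambda>n. vabs (trunc (fps_const (\<lambda>_. c)) h n)) \<longlonglongrightarrow> vabs c"
    by (subst filterlim_sequentially_Suc[symmetric]) simp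
  then show ?thesis
    unfolding eval_norm_def by (rule limI)
qed

lemma eval_norm_one: "eval_norm h 1 = 1"
proof -
  have "(1 :: 'a series) = fps_const (\<lambda>_. 1)"
    by (simp add: one_fun_def[symmetric])
  then show ?thesis using eval_norm_const[of h 1] by simp
qed

lemma eval_norm_zero: "eval_norm h 0 = 0"
  by (simp add: eval_norm_def trunc_def)

lemma eval_norm_add_le:
  assumes "f \<in> int_series d" and "g \<in> int_series d" and "small d h"
  shows "eval_norm h (f + g) \<le> max (eval_norm h f) (eval_norm h g)"
proof (rule LIMSEQ_le)
  show "(\<lambda>n. vabs (trunc (f + g) h n)) \<longlonglongrightarrow> eval_norm h (f + g)"
    using assms by (intro eval_norm_lim int_series_add)
  show "(\<lambda>n. max (vabs (trunc f h n)) (vabs (trunc g h n))) \<longlonglongrightarrow> max (eval_norm h f) (eval_norm h g)"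
    using assms by (intro tendsto_max eval_norm_lim)
  show "\<exists>N. \<forall>n\<ge>N. vabs (trunc (f + g) h n) \<le> max (vabs (trunc f h n)) (vabs (trunc g h n))"
    by (simp add: trunc_def sum.distrib vabs_add_le_max)
qed

lemma eval_norm_uminus: "eval_norm h (- f) = eval_norm h f"
  by (simp add: eval_norm_def trunc_def sum_negf vabs_minus)

lemma eval_norm_sum_le:
  assumes "\<And>i. i \<in> A \<Longrightarrow> f i \<in> int_series d" and "small d h"
    and "\<And>i. i \<in> A \<Longrightarrow> eval_norm h (f i) \<le> c" and "0 \<le> c"
  shows "eval_norm h (sum f A) \<le> c"
  using assms
proof (induction A rule: infinite_finite_induct)
  case (insert x F)
  have "eval_norm h (f x + sum f F) \<le> max (eval_norm h (f x)) (eval_norm h (sum f F))"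
    using insert.prems by (intro eval_norm_add_le[of _ d] int_series_sum) auto
  also have "\<dots> \<le> c"
    using insert by simp
  finally show ?case using insert by simp
qed (simp_all add: eval_norm_zero)

text \<open>The product of the truncations runs over a square of degree pairs, the truncated product
  over a triangle; what lies between has total degree at least \<open>n\<close>.\<close>

lemma trunc_mult_diff_le:
  assumes "f \<in> int_series d" and "g \<in> int_series d" and "small d h"
  shows "vabs (trunc f h n * trunc g h n - trunc (f * g) h n) \<le> (1 / 2) ^ n"
proof -
  let ?t = "\<lambda>(i, j). fps_nth f i h * fps_nth g j h"
  let ?A = "{..<n} \<times> {..<n}" and ?B = "Sigma {..<n} (\<lambda>i. {..<n - i})"
  have B: "trunc (f * g) h n = sum ?t ?B"
  proof -
    have eq: "fps_nth (f * g) k h = (\<Sum>i\<le>k. fps_nth f i h * fps_nth g (k - i) h)" for k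
      by (simp add: fps_mult_nth atLeast0AtMost sum_fun_apply)
    show ?thesis
      unfolding trunc_def eq
      unfolding sum.triangle_reindex[of "\<lambda>i j. fps_nth f i h * fps_nth g j h" n, symmetric]
      by (rule sum.cong) auto
  qed
  have A: "trunc f h n * trunc g h n = sum ?t ?A"
    by (simp add: trunc_def sum_product sum.cartesian_product)
  have "sum ?t ?A - sum ?t ?B = sum ?t (?A - ?B)"
    by (rule sum_diff[symmetric]) auto
  also have "vabs \<dots> \<le> (1 / 2) ^ n"
  proof (rule vabs_sum_le)
    fix p assume "p \<in> ?A - ?B"
    then obtain i j where p: "p = (i, j)" "i + j \<ge> n" by force
    have "vabs (fps_nth f i h * fps_nth g j h) \<le> (1 / 2) ^ (i + j)"
      using hom_fun_bound[OF hom_fun_mult, of d i "fps_nth f i" j "fps_nth g j" h "1 / 2"] assms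
      by (simp add: int_series_def small_def)
    also have "\<dots> \<le> (1 / 2) ^ n"
      using p by (intro power_decreasing) auto
    finally show "vabs (?t p) \<le> (1 / 2) ^ n" using p by simp
  qed simp
  finally show ?thesis using A B by simp
qed

text \<open>Absolute values multiply exactly, and the truncation error is at most
  \<open>(1 / 2) ^ n\<close>, so the argument stays within real limits.\<close>

lemma eval_norm_mult:
  assumes "f \<in> int_series d" and "g \<in> int_series d" and "small d h"
  shows "eval_norm h (f * g) = eval_norm h f * eval_norm h g"
proof -
  have "(\<lambda>n. vabs (trunc f h n * trunc g h n) - vabs (trunc (f * g) h n)) \<longlonglongrightarrow> 0"
  proof (rule Lim_null_comparison)
    show "\<forall>\<^sub>F n in sequentially. norm (vabs (trunc f h n * trunc g h n) - vabs (trunc (f * g) h n)) \<le> (1 / 2) ^ n"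
      using order_trans[OF abs_vabs_diff_le trunc_mult_diff_le[OF assms]] by simp
  qed (simp add: LIMSEQ_power_zero)
  moreover have "(\<lambda>n. vabs (trunc f h n * trunc g h n) - vabs (trunc (f * g) h n))
      \<longlonglongrightarrow> eval_norm h f * eval_norm h g - eval_norm h (f * g)"
    unfolding vabs_mult
    using assms by (intro tendsto_intros eval_norm_lim int_series_mult)
  ultimately show ?thesis
    using LIMSEQ_unique by fastforce
qed

lemma eval_norm_power:
  assumes "f \<in> int_series d" and "small d h"
  shows "eval_norm h (f ^ n) = eval_norm h f ^ n"
  by (induction n)
     (simp_all add: eval_norm_one eval_norm_mult[OF assms(1) int_series_power[OF assms(1)] assms(2)])

section \<open>Weierstrass division\<close>

text \<open>Substitution of the series \<open>x X\<close> for the outer variable; it is formally \<open>\<Sum>\<^sub>k a\<^sub>k (x X)\<^sup>k\<close>.\<close>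

definition collapse :: "'a::comm_ring_1 \<Rightarrow> 'a fps fps \<Rightarrow> 'a fps" where
  "collapse x a = Abs_fps (\<lambda>n. \<Sum>k\<le>n. x ^ k * fps_nth (fps_nth a k) (n - k))"

lemma collapse_add: "collapse x (a + b) = collapse x a + collapse x b"
  by (simp add: collapse_def fps_eq_iff distrib_left sum.distrib)

lemma collapse_0: "collapse x 0 = 0"
  by (simp add: collapse_def fps_eq_iff)

lemma collapse_const: "collapse x (fps_const c) = c"
proof (rule fps_ext)
  fix n
  have "(\<Sum>k\<le>n. x ^ k * fps_nth (fps_nth (fps_const c) k) (n - k))
      = (\<Sum>k\<in>{0}. x ^ k * fps_nth (fps_nth (fps_const c) k) (n - k))"
    by (rule sum.mono_neutral_right) auto
  then show "fps_nth (collapse x (fps_const c)) n = fps_nth c n"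
    by (simp add: collapse_def)
qed

lemma collapse_mult: "collapse x (a * b) = collapse x a * collapse x b"
proof (rule fps_ext)
  fix n
  let ?a = "\<lambda>i j. fps_nth (fps_nth a i) j" and ?b = "\<lambda>i j. fps_nth (fps_nth b i) j"
  have "fps_nth (collapse x (a * b)) n
      = (\<Sum>k\<le>n. \<Sum>i\<le>k. \<Sum>j\<le>n - k. x ^ k * (?a i j * ?b (k - i) (n - k - j)))"
    by (simp add: collapse_def fps_mult_nth fps_sum_nth atLeast0AtMost sum_distrib_left)
  also have "\<dots> = (\<Sum>(k, i, j)\<in>Sigma {..n} (\<lambda>k. {..k} \<times> {..n - k}).
      x ^ k * (?a i j * ?b (k - i) (n - k - j)))"
    by (simp add: sum.Sigma sum.cartesian_product)
  \<comment> \<open>\<open>k\<close> is the exponent of \<open>x\<close> in the product,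
    \<open>p = i + j\<close> the total degree contributed by the first factor, and
    \<open>l = k - i\<close> the exponent of \<open>x\<close> contributed by the second.\<close>
  also have "\<dots> = (\<Sum>(p, i, l)\<in>Sigma {..n} (\<lambda>p. {..p} \<times> {..n - p}).
      x ^ (i + l) * (?a i (p - i) * ?b l (n - p - l)))"
  proof (rule sum.reindex_bij_witness[where i = "\<lambda>(p, i, l). (i + l, i, p - i)"
            and j = "\<lambda>(k, i, j). (i + j, i, k - i)"], goal_cases)
    case (5 t)
    have "n - (i + j) - (k - i) = n - k - j" if "i \<le> k" for i j k :: nat
      using that by simp
    with 5 show ?case by (auto simp: diff_diff_left)
  qed auto
  also have "\<dots> = (\<Sum>(p, i, l)\<in>Sigma {..n} (\<lambda>p. {..p} \<times> {..n - p}).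
      (x ^ i * ?a i (p - i)) * (x ^ l * ?b l (n - p - l)))"
    by (simp add: power_add mult_ac)
  also have "\<dots> = (\<Sum>p\<le>n. \<Sum>i\<le>p. \<Sum>l\<le>n - p. (x ^ i * ?a i (p - i)) * (x ^ l * ?b l (n - p - l)))"
    by (simp add: sum.Sigma sum.cartesian_product)
  also have "\<dots> = fps_nth (collapse x a * collapse x b) n"
    by (simp add: collapse_def fps_mult_nth atLeast0AtMost sum_product)
  finally show "fps_nth (collapse x (a * b)) n = fps_nth (collapse x a * collapse x b) n" .
qed

lemma collapse_power: "collapse x (a ^ n) = collapse x a ^ n"
  using collapse_const[of x 1] by (induction n) (simp_all add: collapse_mult)

lemma collapse_sum: "collapse x (\<Sum>i\<in>A. f i) = (\<Sum>i\<in>A. collapse x (f i))"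
  by (induction A rule: infinite_finite_induct) (simp_all add: collapse_add collapse_0)

text \<open>The coefficient of \<open>T\<^sup>mX\<^sup>j\<close> in the quotient of \<open>F\<close> by \<open>G\<close>, where \<open>G\<close> is regular of
  order \<open>K\<close> in the outer variable \<open>T\<close>, obtained by comparing the coefficients of \<open>T\<^sup>K\<^sup>+\<^sup>mX\<^sup>j\<close>.\<close>

function quot_coeff :: "nat \<Rightarrow> 'a::comm_ring_1 fps fps \<Rightarrow> 'a fps fps \<Rightarrow> nat \<Rightarrow> nat \<Rightarrow> 'a" where
  "quot_coeff K F G j m = fps_nth (fps_nth F (K + m)) j
     - (\<Sum>i\<in>{..<m}. fps_nth (fps_nth G (K + m - i)) 0 * quot_coeff K F G j i)
     - (\<Sum>l\<in>{1..j}. \<Sum>i\<in>{..K + m}. fps_nth (fps_nth G (K + m - i)) l * quot_coeff K F G (j - l) i)"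
  by pat_completeness auto
termination
  by (relation "measures [\<lambda>(K, F, G, j, m). j, \<lambda>(K, F, G, j, m). m]") auto

declare quot_coeff.simps [simp del]

text \<open>The recursion contains no division, so integrality is inherited, and each product in it
  has degree \<open>0 + j\<close> or \<open>l + (j - l)\<close>.\<close>

lemma hom_fun_quot_coeff:
  assumes "\<And>k. fps_nth F k \<in> int_series d" and "\<And>k. fps_nth G k \<in> int_series d"
  shows "hom_fun d j (quot_coeff K F G j m)"
proof (induction "(j, m)" arbitrary: j m rule: wf_induct_rule[OF wf_lex_prod[OF wf_less wf_less]])
  case 1
  have "hom_fun d j (fps_nth (fps_nth G (K + m - i)) 0 * quot_coeff K F G j i)" if "i < m" for i
    using hom_fun_mult[OF int_series_nth[OF assms(2)[of "K + m - i"], of 0] 1[of j i]] that by simp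
  moreover have "hom_fun d j (fps_nth (fps_nth G (K + m - i)) l * quot_coeff K F G (j - l) i)"
    if "l \<in> {1..j}" for i l
    using hom_fun_mult[OF int_series_nth[OF assms(2)[of "K + m - i"], of l] 1[of "j - l" i]] that by simp
  ultimately show ?case
    by (subst quot_coeff.simps)
       (intro hom_fun_diff hom_fun_sum int_series_nth[OF assms(1)]; auto)
qed

text \<open>\<open>quot_coeff\<close> solves exactly the equations saying that
  \<open>F - G * q\<close> has no coefficient of index \<open>K\<close> or higher, so this
  difference is already the remainder.\<close>

lemma weierstrass_division:
  assumes F: "\<And>k. fps_nth F k \<in> int_series d" and G: "\<And>k. fps_nth G k \<in> int_series d"
    and low: "\<And>k. k < K \<Longrightarrow> fps_nth (fps_nth G k) 0 = 0" and lead: "fps_nth (fps_nth G K) 0 = 1"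
  shows "\<exists>q r. (\<forall>k. fps_nth q k \<in> int_series d) \<and> (\<forall>k. r k \<in> int_series d) \<and>
    F = q * G + (\<Sum>k<K. fps_const (r k) * fps_X ^ k)"
proof -
  define q where "q = Abs_fps (\<lambda>m. Abs_fps (\<lambda>j. quot_coeff K F G j m))"
  define R where "R = F - G * q"
  have q: "fps_nth q k \<in> int_series d" for k
    using hom_fun_quot_coeff[of F d G, OF F G] by (simp add: q_def int_series_def)
  have R: "fps_nth R k \<in> int_series d" for k
    using F G q unfolding R_def fps_sub_nth fps_mult_nth
    by (intro int_series_diff int_series_sum int_series_mult)
  have "fps_nth (fps_nth R (K + m)) j = 0" for m j
  proof -
    let ?c = "\<lambda>i l. fps_nth (fps_nth G (K + m - i)) l * quot_coeff K F G (j - l) i"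
    have "fps_nth (fps_nth (q * G) (K + m)) j
        = (\<Sum>i\<le>K + m. \<Sum>l\<le>j. ?c i l)"
      unfolding fps_mult_nth[of q G] mult.commute[of "fps_nth q _"]
      by (simp add: fps_sum_nth fps_mult_nth atLeast0AtMost q_def)
    also have "\<dots> = (\<Sum>i\<le>K + m. ?c i 0 + (\<Sum>l\<in>{1..j}. ?c i l))"
      by (simp add: sum.atMost_shift[of _ j] sum.atLeast1_atMost_eq)
    also have "\<dots> = (\<Sum>i\<le>K + m. ?c i 0) + (\<Sum>l\<in>{1..j}. \<Sum>i\<in>{..K + m}. ?c i l)"
      by (simp only: sum.distrib sum.swap[of _ "{1..j}"])
    \<comment> \<open>Among the constant terms of \<open>G\<close>, \<open>low\<close> removes the
      indices above \<open>m\<close>, and \<open>lead\<close> turns the one at \<open>m\<close> into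
      \<open>quot_coeff K F G j m\<close> itself; the rest is the recursion.\<close>
    also have "(\<Sum>i\<le>K + m. ?c i 0) = (\<Sum>i\<le>m. ?c i 0)"
      by (rule sum.mono_neutral_right) (auto simp: low)
    also have "\<dots> = (\<Sum>i<m. ?c i 0) + quot_coeff K F G j m"
      by (simp add: lead flip: lessThan_Suc_atMost)
    finally have "fps_nth (fps_nth (q * G) (K + m)) j = fps_nth (fps_nth F (K + m)) j"
      by (subst (asm) quot_coeff.simps[of K F G j m]) (simp add: algebra_simps)
    then show ?thesis
      by (simp add: R_def mult.commute)
  qed
  then have "fps_nth R k = 0" if "k \<ge> K" for k
    using that le_Suc_ex[OF that] by (auto simp: fps_eq_iff)
  then have "R = (\<Sum>k<K. fps_const (fps_nth R k) * fps_X ^ k)"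
    by (intro fps_ext[of R]) (auto simp: fps_sum_nth mult_delta_right not_less cong: if_cong)
  moreover have "F = q * G + R"
    by (simp add: R_def mult.commute)
  ultimately have "F = q * G + (\<Sum>k<K. fps_const (fps_nth R k) * fps_X ^ k)"
    by (rule back_subst[of "\<lambda>r. F = q * G + r", rotated])
  then show ?thesis
    using q R by blast
qed

section \<open>Splitting off the last variable\<close>

definition coord :: "nat \<Rightarrow> (nat \<Rightarrow> 'k) \<Rightarrow> 'k" where
  "coord i h = h i"

lemma hom_fun_coord: "i < d \<Longrightarrow> hom_fun d 1 (coord i)"
  using hom_fun_var[of i d] by (simp add: coord_def[abs_def])

lemma collapse_int_series:
  assumes "\<And>k. fps_nth a k \<in> int_series d"
  shows "collapse (coord d) a \<in> int_series (Suc d)"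
proof -
  have "hom_fun (Suc d) n (coord d ^ k * fps_nth (fps_nth a k) (n - k))" if "k \<le> n" for k n
    using hom_fun_mult[OF hom_fun_power[OF hom_fun_coord[of d "Suc d"], of k]
        hom_fun_mono[OF int_series_nth[OF assms], of "Suc d"], of "n - k" k] that by simp
  then show ?thesis
    by (auto simp: int_series_def collapse_def intro!: hom_fun_sum)
qed

lemma power_fun_apply: "(f ^ n) x = (f x :: 'b::comm_ring_1) ^ n"
  by (induction n) simp_all

lemma int_series_Suc_collapse:
  assumes "f \<in> int_series (Suc d)"
  shows "\<exists>a. (\<forall>k. fps_nth a k \<in> int_series d) \<and> f = collapse (coord d) a"
proof -
  have "\<forall>j. \<exists>a. (\<forall>k\<le>j. hom_fun d (j - k) (a k)) \<and> fps_nth f j = (\<lambda>h. \<Sum>k\<le>j. h d ^ k * a k h)"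
    using hom_fun_split[OF int_series_nth[OF assms]] by blast
  then obtain a where a: "\<And>j k. k \<le> j \<Longrightarrow> hom_fun d (j - k) (a j k)"
      "\<And>j. fps_nth f j = (\<lambda>h. \<Sum>k\<le>j. h d ^ k * a j k h)"
    by metis
  \<comment> \<open>The degree-\<open>l\<close> part of the coefficient of the \<open>k\<close>-th
    power comes from the form of total degree \<open>k + l\<close>.\<close>
  let ?b = "Abs_fps (\<lambda>k. Abs_fps (\<lambda>l. a (k + l) k))"
  have "f = collapse (coord d) ?b"
    by (rule fps_ext, rule ext) (simp add: collapse_def a(2) sum_fun_apply power_fun_apply coord_def)
  moreover have "fps_nth ?b k \<in> int_series d" for k
    using a(1)[of k "k + j" for j] by (simp add: int_series_def)
  ultimately show ?thesis by blast
qed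

section \<open>Integral dependence modulo a regular series\<close>

text \<open>Determinants are formed in the ambient ring of all formal series; membership in the
  subring of integral series has to be carried along separately.\<close>

definition ring_closed :: "'a::comm_ring_1 set \<Rightarrow> bool" where
  "ring_closed S \<longleftrightarrow> 0 \<in> S \<and> 1 \<in> S \<and> (\<forall>x\<in>S. - x \<in> S) \<and>
     (\<forall>x\<in>S. \<forall>y\<in>S. x + y \<in> S) \<and> (\<forall>x\<in>S. \<forall>y\<in>S. x * y \<in> S)"

lemma ring_closed_sum: "ring_closed S \<Longrightarrow> (\<And>i. i \<in> A \<Longrightarrow> f i \<in> S) \<Longrightarrow> sum f A \<in> S"
  by (induction A rule: infinite_finite_induct) (auto simp: ring_closed_def)

lemma ring_closed_prod: "ring_closed S \<Longrightarrow> (\<And>i. i \<in> A \<Longrightarrow> f i \<in> S) \<Longrightarrow> prod f A \<in> S"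
  by (induction A rule: infinite_finite_induct) (auto simp: ring_closed_def)

lemma ring_closed_det:
  assumes S: "ring_closed S" and A: "A \<in> carrier_mat n n"
    and entries: "\<And>i j. i < n \<Longrightarrow> j < n \<Longrightarrow> A $$ (i, j) \<in> S"
  shows "det A \<in> S"
  unfolding det_def'[OF A]
proof (rule ring_closed_sum[OF S])
  fix p assume "p \<in> {p. p permutes {0..<n}}"
  then have "p i < n" if "i < n" for i
    using permutes_in_image[of p "{0..<n}" i] that by simp
  then have "(\<Prod>i = 0..<n. A $$ (i, p i)) \<in> S"
    by (intro ring_closed_prod[OF S] entries) auto
  then show "signof p * (\<Prod>i = 0..<n. A $$ (i, p i)) \<in> S"
    using S by (auto simp: ring_closed_def sign_def)
qed

text \<open>Makes \<open>ring_closed_det\<close> applicable to the characteristic matrix, whose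
  entries are polynomials.\<close>

lemma ring_closed_poly:
  assumes S: "ring_closed S"
  shows "ring_closed {p. \<forall>i. coeff p i \<in> S}"
proof -
  have "coeff (p * q) i \<in> S" if "\<forall>i. coeff p i \<in> S" "\<forall>i. coeff q i \<in> S" for p q i
    unfolding coeff_mult using that S by (intro ring_closed_sum[OF S]) (auto simp: ring_closed_def)
  then show ?thesis
    using S by (auto simp: ring_closed_def coeff_1)
qed

lemma coeff_char_poly_closed:
  assumes S: "ring_closed S" and A: "A \<in> carrier_mat n n"
    and entries: "\<And>i j. i < n \<Longrightarrow> j < n \<Longrightarrow> A $$ (i, j) \<in> S"
  shows "coeff (char_poly A) i \<in> S"
proof -
  have "char_poly_matrix A $$ (i, j) \<in> {p. \<forall>i. coeff p i \<in> S}" if "i < n" "j < n" for i j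
    using that A entries[OF that] S
    by (auto simp: char_poly_matrix_def coeff_pCons ring_closed_def split: nat.split)
  then have "det (char_poly_matrix A) \<in> {p. \<forall>i. coeff p i \<in> S}"
    using A by (intro ring_closed_det[OF ring_closed_poly[OF S], of _ n]) auto
  then show ?thesis
    by (simp add: char_poly_def)
qed

text \<open>Cayley--Hamilton: the \<open>c i\<close> are the coefficients of the characteristic polynomial of \<open>r\<close>.\<close>

lemma char_poly_annihilates:
  fixes u g :: "'a::comm_ring_1"
  assumes S: "ring_closed S" and B: "ring_closed B" and "S \<subseteq> B" and u: "u \<in> B"
    and r: "\<And>i k. i < n \<Longrightarrow> k < n \<Longrightarrow> r i k \<in> S" and q: "\<And>i. i < n \<Longrightarrow> q i \<in> B"
    and rel: "\<And>i. i < n \<Longrightarrow> u * w i = g * q i + (\<Sum>k<n. r i k * w k)"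
    and "n > 0" and "w 0 = 1"
  shows "\<exists>c e. (\<forall>i. c i \<in> S) \<and> c n = 1 \<and> e \<in> B \<and> (\<Sum>i\<le>n. c i * u ^ i) = g * e"
proof -
  define A where "A = mat n n (\<lambda>(i, k). r i k)"
  have A: "A \<in> carrier_mat n n" by (simp add: A_def)
  \<comment> \<open>This is \<open>u\<close> times the identity minus \<open>A\<close>; it sends the
    vector \<open>w\<close> to \<open>g * q\<close>.\<close>
  define M where "M = map_mat (\<lambda>p. poly p u) (char_poly_matrix A)"
  have M: "M \<in> carrier_mat n n"
    using A by (simp add: M_def)
  have M_entry: "M $$ (i, k) = (if i = k then u else 0) - r i k" if "i < n" "k < n" for i k
    using that by (simp add: M_def char_poly_matrix_def A_def)
  have det_M: "det M = poly (char_poly A) u"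
    unfolding M_def char_poly_def by (rule comm_ring_hom.hom_det) (unfold_locales; simp)
  have M_w: "(\<Sum>k<n. M $$ (i, k) * w k) = g * q i" if "i < n" for i
  proof -
    have "(\<Sum>k<n. M $$ (i, k) * w k) = (\<Sum>k<n. (if i = k then u * w k else 0) - r i k * w k)"
      using that by (intro sum.cong) (auto simp: M_entry algebra_simps)
    also have "\<dots> = u * w i - (\<Sum>k<n. r i k * w k)"
      using that by (simp add: sum_subtractf)
    finally show ?thesis by (simp add: rel[OF that])
  qed
  have adj: "adj_mat M * M = det M \<cdot>\<^sub>m 1\<^sub>m n" and adj_dim: "adj_mat M \<in> carrier_mat n n"
    using adj_mat[OF M] by auto
  have adj_entry: "(\<Sum>i<n. adj_mat M $$ (0, i) * M $$ (i, k)) = (if k = 0 then det M else 0)" if "k < n" for k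
  proof -
    have "(adj_mat M * M) $$ (0, k) = (\<Sum>i<n. adj_mat M $$ (0, i) * M $$ (i, k))"
      using that M adj_dim \<open>n > 0\<close> by (simp add: scalar_prod_def atLeast0LessThan)
    then show ?thesis
      using that \<open>n > 0\<close> by (cases "k = 0") (simp_all add: adj)
  qed
  define e where "e = (\<Sum>i<n. adj_mat M $$ (0, i) * q i)"
  \<comment> \<open>Row 0 of the adjugate turns the system \<open>M w = g q\<close> into
    \<open>det M * w 0 = g * e\<close>, and \<open>w 0 = 1\<close>.\<close>
  have "g * e = (\<Sum>i<n. adj_mat M $$ (0, i) * (\<Sum>k<n. M $$ (i, k) * w k))"
    by (simp add: e_def M_w sum_distrib_left mult.left_commute)
  also have "\<dots> = (\<Sum>k<n. \<Sum>i<n. adj_mat M $$ (0, i) * M $$ (i, k) * w k)"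
    unfolding sum_distrib_left by (subst sum.swap) (simp add: mult.assoc)
  also have "\<dots> = (\<Sum>k<n. (\<Sum>i<n. adj_mat M $$ (0, i) * M $$ (i, k)) * w k)"
    by (simp add: sum_distrib_right)
  also have "\<dots> = (\<Sum>k<n. if k = 0 then det M * w k else 0)"
    by (intro sum.cong) (auto simp: adj_entry)
  also have "\<dots> = det M"
    using \<open>n > 0\<close> \<open>w 0 = 1\<close> by simp
  finally have "(\<Sum>i\<le>n. coeff (char_poly A) i * u ^ i) = g * e"
    using degree_monic_char_poly[OF A] by (simp add: det_M poly_altdef)
  moreover have "e \<in> B"
  proof -
    have M_B: "M $$ (i, k) \<in> B" if "i < n" "k < n" for i k
    proof -
      have "r i k \<in> B" using r[OF that] \<open>S \<subseteq> B\<close> by blast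
      then have "u + - r i k \<in> B" "0 + - r i k \<in> B"
        using u B unfolding ring_closed_def by blast+
      then show ?thesis unfolding M_entry[OF that] by (cases "i = k") simp_all
    qed
    have "adj_mat M $$ (0, i) \<in> B" if "i < n" for i
    proof -
      have "det (mat_delete M i 0) \<in> B"
        using M that \<open>n > 0\<close> M_B
        by (intro ring_closed_det[OF B, of _ "n - 1"]) (auto simp: mat_delete_def)
      then have "(- 1) ^ (i + 0) * det (mat_delete M i 0) \<in> B"
        using B by (cases "even i") (auto simp: ring_closed_def)
      then show ?thesis
        using M that \<open>n > 0\<close> by (simp add: adj_mat_def cofactor_def)
    qed
    then show ?thesis
      unfolding e_def using q B by (intro ring_closed_sum[OF B]) (auto simp: ring_closed_def)
  qed
  moreover have "coeff (char_poly A) i \<in> S" for i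
    by (rule coeff_char_poly_closed[OF S A]) (simp add: A_def r)
  ultimately show ?thesis
    using degree_monic_char_poly[OF A] by (intro exI[of _ "coeff (char_poly A)"] exI[of _ e]) auto
qed

lemma ring_closed_int_series: "ring_closed (int_series d)"
  by (auto simp: ring_closed_def int_series_0 int_series_1 int_series_uminus int_series_add int_series_mult)

text \<open>Modulo the regular series, the powers \<open>y ^ 0, ..., y ^ (K - 1)\<close> of the last
  variable generate everything over the series in \<open>d\<close> variables. Multiplication by
  \<open>u\<close> is thus given by a square matrix of remainders, and its characteristic polynomial
  is the integral equation.\<close>

lemma integral_dependence:
  fixes u :: "'a::nonarch_valued_field series"
  assumes G: "\<And>k. fps_nth G k \<in> int_series d" and u: "u \<in> int_series (Suc d)"
    and low: "\<And>k. k < K \<Longrightarrow> fps_nth (fps_nth G k) 0 = 0" and lead: "fps_nth (fps_nth G K) 0 = 1"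
  shows "\<exists>c e. (\<forall>i. c i \<in> int_series d) \<and> c K = 1 \<and> e \<in> int_series (Suc d) \<and>
    (\<Sum>i\<le>K. c i * u ^ i) = collapse (coord d) G * e"
proof -
  obtain U where U: "\<And>k. fps_nth U k \<in> int_series d" "u = collapse (coord d) U"
    using int_series_Suc_collapse[OF u] by blast
  define y :: "'a series" where "y = collapse (coord d) fps_X"
  have division: "\<exists>q r. q \<in> int_series (Suc d) \<and> (\<forall>k. r k \<in> int_series d) \<and>
      collapse (coord d) F = collapse (coord d) G * q + (\<Sum>k<K. r k * y ^ k)"
    if F: "\<And>k. fps_nth F k \<in> int_series d" for F
  proof -
    obtain q r where "\<forall>k. fps_nth q k \<in> int_series d" "\<forall>k. r k \<in> int_series d"
      and eq: "F = q * G + (\<Sum>k<K. fps_const (r k) * fps_X ^ k)"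
      using weierstrass_division[OF F G low lead] by blast
    then show ?thesis
      by (intro exI[of _ "collapse (coord d) q"] exI[of _ r])
         (auto simp: collapse_int_series eq collapse_add collapse_sum collapse_mult collapse_power
             collapse_const y_def mult.commute)
  qed
  show ?thesis
  proof (cases "K = 0")
    \<comment> \<open>The matrix would be empty. A series regular of order 0 is a unit: dividing 1
      by it leaves no remainder.\<close>
    case True
    have "fps_nth 1 k \<in> int_series d" for k
      by (simp add: int_series_0 int_series_1)
    then obtain q where "q \<in> int_series (Suc d)" "collapse (coord d) 1 = collapse (coord d) G * q"
      using division[of 1] True by auto
    moreover have "collapse (coord d) 1 = (1 :: 'a series)"
      using collapse_const[of "coord d" 1] by simp
    ultimately show ?thesis
      using True by (intro exI[of _ "\<lambda>_. 1"] exI[of _ q]) (simp add: int_series_1)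
  next
    case False
    have "fps_nth (U * fps_X ^ i) k \<in> int_series d" for i k
      using U(1) by (auto simp: fps_X_power_mult_right_nth int_series_0)
    then have "\<forall>i. \<exists>q r. q \<in> int_series (Suc d) \<and> (\<forall>k. r k \<in> int_series d) \<and>
        u * y ^ i = collapse (coord d) G * q + (\<Sum>k<K. r k * y ^ k)"
      using division[of "U * fps_X ^ i" for i] by (simp add: collapse_mult collapse_power U(2) y_def)
    then obtain q where "\<forall>i. \<exists>r. q i \<in> int_series (Suc d) \<and> (\<forall>k. r k \<in> int_series d) \<and>
        u * y ^ i = collapse (coord d) G * q i + (\<Sum>k<K. r k * y ^ k)"
      by (rule choice[THEN exE])
    then obtain r where "\<forall>i. q i \<in> int_series (Suc d) \<and> (\<forall>k. r i k \<in> int_series d) \<and>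
        u * y ^ i = collapse (coord d) G * q i + (\<Sum>k<K. r i k * y ^ k)"
      by (rule choice[THEN exE])
    then have qr: "\<And>i. q i \<in> int_series (Suc d)" "\<And>i k. r i k \<in> int_series d"
      "\<And>i. u * y ^ i = collapse (coord d) G * q i + (\<Sum>k<K. r i k * y ^ k)"
      by blast+
    show ?thesis
      using False qr u
      by (intro char_poly_annihilates[where w = "\<lambda>i. y ^ i" and q = q and r = r] ring_closed_int_series)
         (auto intro: int_series_mono)
  qed
qed

section \<open>Series in \<open>d\<close> variables have at most \<open>d\<close> scales\<close>

text \<open>These are \<open>d + 1\<close> sizes \<open>t 0, ..., t d\<close>; the last is bounded
  only from above and may be 0. One parameter controls both the smallness of \<open>t 0\<close> and
  the gaps.\<close>

definition lacunary :: "nat \<Rightarrow> nat \<Rightarrow> (nat \<Rightarrow> real) \<Rightarrow> bool" where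
  "lacunary N d t \<longleftrightarrow> t 0 \<le> (1 / 2) ^ N \<and> (\<forall>j<d. 0 < t j \<and> t (Suc j) \<le> t j ^ N)"

lemma lacunary_le_1: "lacunary N d t \<Longrightarrow> j \<le> d \<Longrightarrow> t j \<le> 1"
proof (induction j)
  case 0
  then show ?case by (auto simp: lacunary_def intro: order_trans[OF _ power_le_one])
next
  case (Suc j)
  then have "t j ^ N \<le> 1" "t (Suc j) \<le> t j ^ N"
    by (auto simp: lacunary_def less_imp_le intro!: power_le_one)
  then show ?case by simp
qed

lemma lacunary_mono:
  assumes "lacunary N d t" and "M \<le> N"
  shows "lacunary M d t"
  unfolding lacunary_def
proof (intro conjI allI impI)
  have "(1 / 2 :: real) ^ N \<le> (1 / 2) ^ M"
    using assms(2) by (intro power_decreasing) auto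
  moreover have "t 0 \<le> (1 / 2) ^ N"
    using assms(1) by (simp add: lacunary_def)
  ultimately show "t 0 \<le> (1 / 2) ^ M" by linarith
  fix j assume "j < d"
  then have j: "0 < t j" "t j \<le> 1" "t (Suc j) \<le> t j ^ N"
    using assms(1) lacunary_le_1[OF assms(1), of j] by (auto simp: lacunary_def)
  show "0 < t j" by fact
  have "t j ^ N \<le> t j ^ M"
    using j assms(2) by (intro power_decreasing) auto
  then show "t (Suc j) \<le> t j ^ M" using j by simp
qed

lemma lacunary_Suc_le: "lacunary N d t \<Longrightarrow> 1 \<le> N \<Longrightarrow> j < d \<Longrightarrow> t (Suc j) \<le> t j"
  using lacunary_mono[of N d t 1] by (simp add: lacunary_def)

lemma lacunary_decreasing:
  assumes "lacunary N d t" and "1 \<le> N" and "i \<le> j" and "j \<le> d"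
  shows "t j \<le> t i"
  using assms(3,4)
proof (induction j rule: dec_induct)
  case (step j)
  then show ?case using lacunary_Suc_le[OF assms(1,2), of j] by simp
qed simp

text \<open>The same \<open>N\<close> bounds the radius of the ball and the order of lacunarity.
  Both conditions become stricter as \<open>N\<close> grows, so \<open>N\<close> may be enlarged to
  absorb constants lost on the way.\<close>

definition scales_bounded :: "nat \<Rightarrow> (nat \<Rightarrow> 'k::nonarch_valued_field series) \<Rightarrow> bool" where
  "scales_bounded d u \<longleftrightarrow>
     (\<exists>N. \<forall>h. (\<forall>i<d. vabs (h i) \<le> (1 / 2) ^ N) \<longrightarrow> \<not> lacunary N d (\<lambda>j. eval_norm h (u j)))"

lemma scales_boundedE:
  assumes "scales_bounded d u"
  obtains N where "\<And>M h. N \<le> M \<Longrightarrow> \<forall>i<d. vabs (h i) \<le> (1 / 2) ^ M \<Longrightarrow>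
    \<not> lacunary M d (\<lambda>j. eval_norm h (u j))"
proof -
  obtain N where N: "\<And>h. \<forall>i<d. vabs (h i) \<le> (1 / 2) ^ N \<Longrightarrow> \<not> lacunary N d (\<lambda>j. eval_norm h (u j))"
    using assms unfolding scales_bounded_def by blast
  have "\<not> lacunary M d (\<lambda>j. eval_norm h (u j))"
    if "N \<le> M" "\<forall>i<d. vabs (h i) \<le> (1 / 2) ^ M" for M h
  proof -
    have "(1 / 2 :: real) ^ M \<le> (1 / 2) ^ N"
      using that(1) by (intro power_decreasing) auto
    then have "\<forall>i<d. vabs (h i) \<le> (1 / 2) ^ N"
      using that(2) by (meson order_trans)
    then show ?thesis
      using N lacunary_mono[OF _ that(1)] by blast
  qed
  then show ?thesis using that by blast
qed

text \<open>The maximum of the \<open>|c\<^sub>i| |u|\<^sup>i\<close> is attained twice; the first index attaining it has the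
  required size.\<close>

lemma coefficient_selection:
  assumes h: "small d h" and c: "\<And>i. c i \<in> int_series d" and "c K = 1" and u: "u \<in> int_series d"
    and t: "t = eval_norm h u" "0 < t" "t < 1"
    and sum_small: "eval_norm h (\<Sum>i\<le>K. c i * u ^ i) < t ^ K"
  shows "\<exists>a\<le>K. t ^ K \<le> eval_norm h (c a) \<and> eval_norm h (c a) \<le> t"
proof -
  define v where "v i = eval_norm h (c i * u ^ i)" for i
  have in_ser: "c i * u ^ i \<in> int_series d" for i
    using c u by (intro int_series_mult int_series_power)
  have v_eq: "v i = eval_norm h (c i) * t ^ i" for i
    unfolding v_def t(1) using eval_norm_mult[OF c int_series_power[OF u] h] eval_norm_power[OF u h] by simp
  have c01: "0 \<le> eval_norm h (c i)" "eval_norm h (c i) \<le> 1" for i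
    using eval_norm_nonneg[OF c h] eval_norm_le_1[OF c h] by auto
  define P where "P i \<longleftrightarrow> i \<le> K \<and> (\<forall>k\<le>K. v k \<le> v i)" for i
  have "Max (v ` {..K}) \<in> v ` {..K}"
    by (rule Max_in) auto
  then obtain i where "Max (v ` {..K}) = v i" "i \<in> {..K}" by (rule imageE)
  moreover have "v k \<le> Max (v ` {..K})" if "k \<le> K" for k
    using that by simp
  ultimately have "P i" by (simp add: P_def)
  define a where "a = Least P"
  have a: "P a" using \<open>P i\<close> unfolding a_def by (rule LeastI)
  have less_a: "v i < v a" if "i < a" for i
  proof -
    have "\<not> P i" using that not_less_Least unfolding a_def by blast
    moreover have "i \<le> K" using that a by (simp add: P_def)
    ultimately obtain k where "k \<le> K" "v i < v k"
      by (auto simp: P_def not_le)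
    then show ?thesis using a by (auto simp: P_def intro: less_le_trans)
  qed
  have "v K = t ^ K"
    using \<open>c K = 1\<close> by (simp add: v_eq eval_norm_one)
  then have va: "t ^ K \<le> v a" using a by (metis P_def order_refl)
  have "v a \<le> eval_norm h (c a)"
    unfolding v_eq using c01[of a] t by (simp add: mult_left_le power_le_one)
  moreover have "eval_norm h (c a) \<le> t"
  proof (rule ccontr)
    assume "\<not> eval_norm h (c a) \<le> t"
    \<comment> \<open>With \<open>eval_norm h (c a) > t\<close> an index above \<open>a\<close>
      loses: its value is at most \<open>t ^ Suc a\<close>, which is below
      \<open>eval_norm h (c a) * t ^ a\<close>. Below \<open>a\<close>, minimality gives strictness.
      So \<open>v a\<close> is a strict maximum and cannot be cancelled in the sum.\<close>
    have less: "v i < v a" if "i \<le> K" "i \<noteq> a" for i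
    proof (cases "i < a")
      case False
      then have "Suc a \<le> i" using that by simp
      have "v i \<le> t ^ i"
        unfolding v_eq using c01[of i] t by (simp add: mult_left_le_one_le)
      also have "\<dots> \<le> t ^ Suc a"
        using t \<open>Suc a \<le> i\<close> by (intro power_decreasing) auto
      also have "\<dots> < v a"
        unfolding v_eq using \<open>\<not> _ \<le> t\<close> t by simp
      finally show ?thesis .
    qed (rule less_a)
    \<comment> \<open>Inserting 0 provides a maximum also for \<open>K = 0\<close>, where no other
      index exists.\<close>
    define m where "m = Max (insert 0 (v ` ({..K} - {a})))"
    have "0 < v a" using va t by (meson less_le_trans zero_less_power)
    then have m: "m < v a" "0 \<le> m"
      using less by (auto simp: m_def)
    have "eval_norm h (\<Sum>i\<in>{..K} - {a}. c i * u ^ i) \<le> m"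
      using in_ser h m(2) by (intro eval_norm_sum_le[of _ _ d]) (auto simp: m_def v_def)
    moreover have "c a * u ^ a = (\<Sum>i\<le>K. c i * u ^ i) + - (\<Sum>i\<in>{..K} - {a}. c i * u ^ i)"
      using a by (subst sum.remove[of _ a]) (auto simp: P_def)
    then have "v a \<le> max (eval_norm h (\<Sum>i\<le>K. c i * u ^ i)) (eval_norm h (\<Sum>i\<in>{..K} - {a}. c i * u ^ i))"
      unfolding v_def
      using eval_norm_add_le[OF int_series_sum int_series_uminus[OF int_series_sum] h,
          of "{..K}" "\<lambda>i. c i * u ^ i" "{..K} - {a}" "\<lambda>i. c i * u ^ i"] in_ser
      by (simp add: eval_norm_uminus)
    ultimately show False
      using m va sum_small by linarith
  qed
  ultimately show ?thesis
    using va a by (intro exI[of _ a]) (auto simp: P_def)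
qed

text \<open>At a lacunary point the value of the last series is below \<open>t j ^ K\<close> for
  every \<open>j \<le> d\<close>, so each integral equation modulo that series yields a coefficient
  of size between \<open>t j ^ K\<close> and \<open>t j\<close>. These \<open>d + 1\<close>
  coefficients contradict the hypothesis on series in \<open>d\<close> variables.\<close>

lemma scales_bounded_regular:
  fixes u :: "nat \<Rightarrow> 'k::nonarch_valued_field series"
  assumes IH: "\<And>v :: nat \<Rightarrow> 'k series. (\<And>j. v j \<in> int_series d) \<Longrightarrow> v d \<noteq> 0 \<Longrightarrow> scales_bounded d v"
    and u: "\<And>j. u j \<in> int_series (Suc d)"
    and G: "\<And>k. fps_nth G k \<in> int_series d" and uG: "u (Suc d) = collapse (coord d) G"
    and low: "\<And>k. k < K \<Longrightarrow> fps_nth (fps_nth G k) 0 = 0" and lead: "fps_nth (fps_nth G K) 0 = 1"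
  shows "scales_bounded (Suc d) u"
proof -
  have "\<forall>j. \<exists>c. (\<forall>i. c i \<in> int_series d) \<and> c K = 1 \<and>
      (\<exists>e. e \<in> int_series (Suc d) \<and> (\<Sum>i\<le>K. c i * u j ^ i) = u (Suc d) * e)"
    using integral_dependence[OF G u low lead] unfolding uG by blast
  then obtain c where "\<forall>j. (\<forall>i. c j i \<in> int_series d) \<and> c j K = 1 \<and>
      (\<exists>e. e \<in> int_series (Suc d) \<and> (\<Sum>i\<le>K. c j i * u j ^ i) = u (Suc d) * e)"
    by (rule choice[THEN exE])
  then have c: "\<And>i j. c j i \<in> int_series d" "\<And>j. c j K = 1"
    "\<And>j. \<exists>e. e \<in> int_series (Suc d) \<and> (\<Sum>i\<le>K. c j i * u j ^ i) = u (Suc d) * e"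
    by blast+
  \<comment> \<open>The selected indices depend on \<open>h\<close> but range over this finite set,
    so the maximum of the corresponding exponents serves every \<open>h\<close>.\<close>
  define A where "A = PiE {..d} (\<lambda>_. {..K})"
  have "finite A" unfolding A_def by (intro finite_PiE) auto
  \<comment> \<open>The hypothesis needs a nonzero last series. A vanishing \<open>c d (a d)\<close>
    is never selected, since its value 0 would have to be at least
    \<open>t d ^ K > 0\<close>.\<close>
  have "\<forall>a. \<exists>N. c d (a d) \<noteq> 0 \<longrightarrow> (\<forall>M h. N \<le> M \<longrightarrow> (\<forall>i<d. vabs (h i) \<le> (1 / 2) ^ M) \<longrightarrow>
      \<not> lacunary M d (\<lambda>j. eval_norm h (c j (a j))))"
  proof
    fix a
    show "\<exists>N. c d (a d) \<noteq> 0 \<longrightarrow> (\<forall>M h. N \<le> M \<longrightarrow> (\<forall>i<d. vabs (h i) \<le> (1 / 2) ^ M) \<longrightarrow>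
      \<not> lacunary M d (\<lambda>j. eval_norm h (c j (a j))))"
    proof (cases "c d (a d) = 0")
      case False
      then have "scales_bounded d (\<lambda>j. c j (a j))"
        by (intro IH c(1))
      then obtain N where "\<And>M h. N \<le> M \<Longrightarrow> \<forall>i<d. vabs (h i) \<le> (1 / 2) ^ M \<Longrightarrow>
          \<not> lacunary M d (\<lambda>j. eval_norm h (c j (a j)))"
        using scales_boundedE by blast
      then show ?thesis by blast
    qed simp
  qed
  then obtain N where N: "\<forall>a. c d (a d) \<noteq> 0 \<longrightarrow> (\<forall>M h. N a \<le> M \<longrightarrow>
      (\<forall>i<d. vabs (h i) \<le> (1 / 2) ^ M) \<longrightarrow> \<not> lacunary M d (\<lambda>j. eval_norm h (c j (a j))))"
    by (rule choice[THEN exE])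
  define N0 where "N0 = Max (insert 0 (N ` A))"
  have N0: "N a \<le> N0" if "a \<in> A" for a
    using that \<open>finite A\<close> by (simp add: N0_def)
  \<comment> \<open>\<open>N0\<close> serves the radius and the first size, \<open>K * N0\<close>
    the comparison of \<open>t j ^ M\<close> with \<open>(t j ^ K) ^ N0\<close>, and
    \<open>K + 1\<close> the strict inequality \<open>t j ^ M < t j ^ K\<close>; the 1 also puts
    \<open>h\<close> into the ball of radius 1/2.\<close>
  define M where "M = N0 + K * N0 + K + 1"
  have "\<not> lacunary M (Suc d) (\<lambda>j. eval_norm h (u j))"
    if h: "\<forall>i<Suc d. vabs (h i) \<le> (1 / 2) ^ M" for h
  proof
    assume lac: "lacunary M (Suc d) (\<lambda>j. eval_norm h (u j))"
    define t where "t j = eval_norm h (u j)" for j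
    note lac = lac[folded t_def]
    have "(1 / 2 :: real) ^ M \<le> (1 / 2) ^ 1"
      unfolding M_def by (intro power_decreasing) auto
    then have "small (Suc d) h" and half: "(1 / 2 :: real) ^ M \<le> 1 / 2"
      using h by (auto simp: small_def intro: order_trans)
    note h' = \<open>small (Suc d) h\<close>
    have t_pos: "0 < t j" if "j \<le> d" for j
      using lac that by (simp add: lacunary_def)
    have t_less: "t j < 1" if "j \<le> Suc d" for j
      using lacunary_decreasing[OF lac _ le0[of j] that] lac half by (auto simp: lacunary_def M_def)
    have "\<exists>a\<le>K. t j ^ K \<le> eval_norm h (c j a) \<and> eval_norm h (c j a) \<le> t j" if "j \<le> d" for j
    proof (rule coefficient_selection[of "Suc d" h "c j" K "u j" "t j",
          OF h' int_series_mono[OF c(1)] c(2) u t_def t_pos[OF that] t_less])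
      obtain e where e: "e \<in> int_series (Suc d)" "(\<Sum>i\<le>K. c j i * u j ^ i) = u (Suc d) * e"
        using c(3) by blast
      have "eval_norm h (\<Sum>i\<le>K. c j i * u j ^ i) = t (Suc d) * eval_norm h e"
        unfolding e(2) t_def by (rule eval_norm_mult[OF u e(1) h'])
      also have "\<dots> \<le> t (Suc d)"
        using eval_norm_le_1[OF e(1) h'] eval_norm_nonneg[OF u h', of "Suc d"]
        by (simp add: t_def mult_left_le)
      also have "\<dots> \<le> t (Suc j)"
        using that by (intro lacunary_decreasing[OF lac]) (auto simp: M_def)
      also have "\<dots> \<le> t j ^ M"
        using lac that by (simp add: lacunary_def)
      also have "\<dots> < t j ^ K"
        using that t_pos[OF that] t_less[of j] by (intro power_strict_decreasing) (auto simp: M_def)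
      finally show "eval_norm h (\<Sum>i\<le>K. c j i * u j ^ i) < t j ^ K" .
    qed (use that in auto)
    then have "\<forall>j. \<exists>a. j \<le> d \<longrightarrow> a \<le> K \<and> t j ^ K \<le> eval_norm h (c j a) \<and> eval_norm h (c j a) \<le> t j"
      by blast
    then obtain a0 where a0: "\<forall>j. j \<le> d \<longrightarrow> a0 j \<le> K \<and> t j ^ K \<le> eval_norm h (c j (a0 j)) \<and>
        eval_norm h (c j (a0 j)) \<le> t j"
      by (rule choice[THEN exE])
    \<comment> \<open>Values outside \<open>{..d}\<close> are made undefined so that
      \<open>a\<close> belongs to the finite set \<open>A\<close>.\<close>
    define a where "a = restrict a0 {..d}"
    have "a \<in> A" using a0 by (auto simp: a_def A_def)
    have a: "t j ^ K \<le> eval_norm h (c j (a j))" "eval_norm h (c j (a j)) \<le> t j" if "j \<le> d" for j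
      using a0 that by (auto simp: a_def)
    have "c d (a d) \<noteq> 0"
    proof
      assume "c d (a d) = 0"
      then have "t d ^ K \<le> 0"
        using a(1)[of d] by (simp add: eval_norm_zero)
      then show False using zero_less_power[OF t_pos[of d], of K] by simp
    qed
    moreover have "\<forall>i<d. vabs (h i) \<le> (1 / 2) ^ N0"
    proof (intro allI impI)
      fix i assume "i < d"
      then have "vabs (h i) \<le> (1 / 2) ^ M" using h by simp
      also have "\<dots> \<le> (1 / 2) ^ N0" by (intro power_decreasing) (auto simp: M_def)
      finally show "vabs (h i) \<le> (1 / 2) ^ N0" .
    qed
    moreover have "lacunary N0 d (\<lambda>j. eval_norm h (c j (a j)))"
      unfolding lacunary_def
    proof (intro conjI allI impI)
      have "eval_norm h (c 0 (a 0)) \<le> t 0" by (rule a) simp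
      also have "\<dots> \<le> (1 / 2) ^ M" using lac by (simp add: lacunary_def)
      also have "\<dots> \<le> (1 / 2) ^ N0" by (intro power_decreasing) (auto simp: M_def)
      finally show "eval_norm h (c 0 (a 0)) \<le> (1 / 2) ^ N0" .
      fix j assume "j < d"
      have pos: "0 < t j ^ K" using t_pos[of j] \<open>j < d\<close> by simp
      then show "0 < eval_norm h (c j (a j))"
        using a(1)[of j] \<open>j < d\<close> by linarith
      have "eval_norm h (c (Suc j) (a (Suc j))) \<le> t (Suc j)"
        using \<open>j < d\<close> by (intro a) simp
      also have "\<dots> \<le> t j ^ M" using lac \<open>j < d\<close> by (simp add: lacunary_def)
      also have "\<dots> \<le> t j ^ (K * N0)"
        using t_pos[of j] t_less[of j] \<open>j < d\<close> by (intro power_decreasing) (auto simp: M_def)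
      also have "\<dots> \<le> eval_norm h (c j (a j)) ^ N0"
        unfolding power_mult using pos a(1)[of j] \<open>j < d\<close> by (intro power_mono) auto
      finally show "eval_norm h (c (Suc j) (a (Suc j))) \<le> eval_norm h (c j (a j)) ^ N0" .
    qed
    ultimately show False
      using N N0[OF \<open>a \<in> A\<close>] by blast
  qed
  then show ?thesis
    unfolding scales_bounded_def by blast
qed

section \<open>Linear changes of variables and rescaling\<close>

definition subst_series ::
  "((nat \<Rightarrow> 'k) \<Rightarrow> (nat \<Rightarrow> 'k)) \<Rightarrow> 'k::nonarch_valued_field series \<Rightarrow> 'k series" where
  "subst_series L f = Abs_fps (\<lambda>j h. fps_nth f j (L h))"

lemma int_series_subst:
  assumes "\<And>i. i < d \<Longrightarrow> hom_fun e 1 (\<lambda>h. L h i)" and "f \<in> int_series d"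
  shows "subst_series L f \<in> int_series e"
  using assms by (auto simp: int_series_def subst_series_def intro: hom_fun_subst)

lemma eval_norm_subst: "eval_norm h (subst_series L f) = eval_norm (L h) f"
  by (simp add: eval_norm_def trunc_def subst_series_def)

lemma eval_norm_cong:
  assumes "f \<in> int_series d" and "\<And>i. i < d \<Longrightarrow> h i = h' i"
  shows "eval_norm h f = eval_norm h' f"
proof -
  have "trunc f h n = trunc f h' n" for n
    unfolding trunc_def
    by (rule sum.cong[OF refl]) (rule hom_fun_cong[OF int_series_nth[OF assms(1)] assms(2)])
  then show ?thesis by (simp add: eval_norm_def)
qed

lemma half_power_le:
  assumes "0 < (e::real)"
  obtains B :: nat where "(1 / 2) ^ B \<le> e"
  using real_arch_pow_inv[OF assms, of "1 / 2"] by (auto intro: less_imp_le)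

text \<open>\<open>M\<close> is a right inverse of \<open>L\<close> on the first \<open>d\<close>
  coordinates and expands norms by at most \<open>1 / e\<close>, so a small \<open>h\<close> is the
  image of the still small point \<open>M h\<close>. The loss \<open>(1 / 2) ^ B \<le> e\<close> is
  absorbed in the exponent.\<close>

lemma scales_bounded_subst:
  assumes u: "\<And>j. u j \<in> int_series d"
    and inv: "\<And>h i. i < d \<Longrightarrow> L (M h) i = h i"
    and e: "0 < e" "\<And>h r i. 0 \<le> r \<Longrightarrow> \<forall>i<d. vabs (h i) \<le> r * e \<Longrightarrow> i < d \<Longrightarrow> vabs (M h i) \<le> r"
    and bounded: "scales_bounded d (\<lambda>j. subst_series L (u j))"
  shows "scales_bounded d u"
proof -
  obtain N where N: "\<And>n h. N \<le> n \<Longrightarrow> \<forall>i<d. vabs (h i) \<le> (1 / 2) ^ n \<Longrightarrow>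
      \<not> lacunary n d (\<lambda>j. eval_norm h (subst_series L (u j)))"
    using scales_boundedE[OF bounded] by blast
  obtain B where B: "(1 / 2) ^ B \<le> e"
    using half_power_le[OF e(1)] .
  have "\<not> lacunary (N + B) d (\<lambda>j. eval_norm h (u j))"
    if h: "\<forall>i<d. vabs (h i) \<le> (1 / 2) ^ (N + B)" for h
  proof
    assume lac: "lacunary (N + B) d (\<lambda>j. eval_norm h (u j))"
    have "(1 / 2 :: real) ^ (N + B) \<le> (1 / 2) ^ N * e"
      unfolding power_add by (intro mult_left_mono B) simp
    then have "\<forall>i<d. vabs (h i) \<le> (1 / 2) ^ N * e"
      using h order_trans by blast
    then have "\<forall>i<d. vabs (M h i) \<le> (1 / 2) ^ N"
      using e(2)[of "(1 / 2) ^ N" h] by auto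
    moreover have "eval_norm (M h) (subst_series L (u j)) = eval_norm h (u j)" for j
      unfolding eval_norm_subst by (rule eval_norm_cong[OF u inv])
    ultimately show False
      using N[of N "M h"] lacunary_mono[OF lac, of N] by simp
  qed
  then show ?thesis unfolding scales_bounded_def by blast
qed

text \<open>Dividing the last series by \<open>c\<close> enlarges its value by the fixed factor
  \<open>1 / vabs c\<close>, which finitely many further powers of the preceding size outweigh once
  that size is at most 1/2.\<close>

lemma scales_bounded_const_mult:
  assumes g: "g \<in> int_series (Suc d)" and c: "c \<noteq> 0" "vabs c \<le> 1"
    and eq: "u (Suc d) = fps_const (\<lambda>_. c) * g"
    and bounded: "scales_bounded (Suc d) (u(Suc d := g))"
  shows "scales_bounded (Suc d) u"
proof -
  obtain N where N: "\<And>n h. N \<le> n \<Longrightarrow> \<forall>i<Suc d. vabs (h i) \<le> (1 / 2) ^ n \<Longrightarrow>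
      \<not> lacunary n (Suc d) (\<lambda>j. eval_norm h ((u(Suc d := g)) j))"
    using scales_boundedE[OF bounded] by blast
  obtain B where B: "(1 / 2) ^ B \<le> vabs c"
    using half_power_le[of "vabs c"] c by (auto simp: vabs_pos_iff)
  \<comment> \<open>\<open>B\<close> pays for the constant; the 1 puts \<open>h\<close> into the
    ball of radius 1/2 and gives \<open>t d \<le> 1 / 2\<close>.\<close>
  define n where "n = N + B + 1"
  have "\<not> lacunary n (Suc d) (\<lambda>j. eval_norm h (u j))"
    if h: "\<forall>i<Suc d. vabs (h i) \<le> (1 / 2) ^ n" for h
  proof
    assume lac: "lacunary n (Suc d) (\<lambda>j. eval_norm h (u j))"
    have half: "(1 / 2 :: real) ^ n \<le> (1 / 2) ^ 1" "(1 / 2 :: real) ^ n \<le> (1 / 2) ^ N"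
      by (intro power_decreasing; simp add: n_def)+
    have h': "small (Suc d) h"
      unfolding small_def
    proof (intro allI impI)
      fix i assume "i < Suc d"
      with h half(1) show "vabs (h i) \<le> 1 / 2"
        by (metis order_trans power_one_right)
    qed
    define t where "t j = eval_norm h (u j)" for j
    note lac = lac[folded t_def]
    have t0: "t 0 \<le> (1 / 2) ^ n" using lac by (simp add: lacunary_def)
    have td: "0 < t d" "t (Suc d) \<le> t d ^ n" using lac by (auto simp: lacunary_def)
    have "t d \<le> t 0" using lac by (intro lacunary_decreasing[OF lac]) (auto simp: n_def)
    then have "t d \<le> 1 / 2" using t0 half(1) by (simp only: power_one_right)
    have "vabs c * eval_norm h g = t (Suc d)"
      unfolding t_def eq using eval_norm_mult[OF int_series_const[OF c(2)] g h'] by (simp add: eval_norm_const)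
    also have "\<dots> \<le> t d ^ n" by (rule td)
    also have "\<dots> \<le> t d ^ (N + B)"
      using td(1) \<open>t d \<le> 1 / 2\<close> by (intro power_decreasing) (auto simp: n_def)
    also have "\<dots> = t d ^ N * t d ^ B" by (rule power_add)
    also have "t d ^ B \<le> (1 / 2) ^ B"
      using td(1) \<open>t d \<le> 1 / 2\<close> by (intro power_mono) auto
    also note B
    finally have "vabs c * eval_norm h g \<le> vabs c * t d ^ N"
      using td(1) by (simp add: mult_left_mono mult.commute)
    then have g_le: "eval_norm h g \<le> t d ^ N"
      using c by (simp add: vabs_pos_iff)
    have "lacunary N (Suc d) t"
      by (rule lacunary_mono[OF lac]) (simp add: n_def)
    then have "lacunary N (Suc d) (\<lambda>j. eval_norm h ((u(Suc d := g)) j))"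
      using g_le by (auto simp: lacunary_def t_def less_Suc_eq)
    moreover have "\<forall>i<Suc d. vabs (h i) \<le> (1 / 2) ^ N"
      using h half(2) order_trans by blast
    ultimately show False using N by blast
  qed
  then show ?thesis unfolding scales_bounded_def by blast
qed

text \<open>On the line through a point with \<open>f a \<noteq> 0\<close> in the last coordinate
  direction, \<open>f\<close> is a nonzero polynomial; an infinite field has a parameter avoiding
  its roots and the point with last coordinate 0. Homogeneity then normalises this coordinate to 1,
  so that \<open>c\<close> can replace the last basis vector in an invertible change of
  variables.\<close>

lemma hom_fun_regular_direction:
  assumes "infinite (UNIV :: 'k::nonarch_valued_field set)"
    and f: "hom_fun (Suc d) n (f :: (nat \<Rightarrow> 'k) \<Rightarrow> 'k)" and "f \<noteq> 0"
  shows "\<exists>c. c d = 1 \<and> f c \<noteq> 0"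
proof -
  obtain a where a: "f a \<noteq> 0"
    using \<open>f \<noteq> 0\<close> by (auto simp: fun_eq_iff)
  define b :: "nat \<Rightarrow> 'k" where "b i = (if i = d then 1 else 0)" for i
  obtain P where P: "\<forall>s. f (\<lambda>i. a i + s * b i) = poly P s"
    using hom_fun_line_poly[OF f] by blast
  have "poly P 0 \<noteq> 0"
    using P[rule_format, of 0] a by simp
  then have "P \<noteq> 0" by auto
  then have "finite ({s. poly P s = 0} \<union> {- a d})"
    using poly_roots_finite[of P] by simp
  then obtain s where s: "poly P s \<noteq> 0" "s \<noteq> - a d"
    using ex_new_if_finite[OF assms(1), of "{s. poly P s = 0} \<union> {- a d}"] by auto
  define a' where "a' i = a i + s * b i" for i
  have "f a' \<noteq> 0" using s P by (simp add: a'_def[abs_def])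
  moreover have "a' d \<noteq> 0"
    using s(2) by (auto simp: a'_def b_def add_eq_0_iff add.commute)
  ultimately show ?thesis
    using hom_fun_scale_arg[OF f, of "1 / a' d" a'] by (intro exI[of _ "\<lambda>i. 1 / a' d * a' i"]) auto
qed

lemma exists_common_small:
  fixes c :: "nat \<Rightarrow> 'k::nonarch_valued_field"
  assumes "\<exists>x::'k. x \<noteq> 0 \<and> vabs x \<noteq> 1"
  shows "\<exists>b::'k. b \<noteq> 0 \<and> vabs b \<le> 1 \<and> (\<forall>i<n. vabs (b * c i) \<le> 1)"
proof -
  define m where "m = Max (insert 1 ((\<lambda>i. vabs (c i)) ` {..<n}))"
  have "1 \<le> m" unfolding m_def by (rule Max_ge) auto
  have m: "vabs (c i) \<le> m" if "i < n" for i
    using that by (auto simp: m_def intro!: Max_ge)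
  obtain b :: 'k where b: "b \<noteq> 0" "vabs b < 1 / m"
    using exists_small[OF assms, of "1 / m"] \<open>1 \<le> m\<close> by auto
  have "vabs b * m \<le> 1" using b(2) \<open>1 \<le> m\<close> by (simp add: field_simps)
  moreover have "vabs b \<le> vabs b * m"
    using mult_left_mono[OF \<open>1 \<le> m\<close> vabs_nonneg[of b]] by simp
  moreover have "vabs (b * c i) \<le> vabs b * m" if "i < n" for i
    using m[OF that] by (simp add: vabs_mult mult_left_mono vabs_nonneg)
  ultimately show ?thesis
    using b(1) by (meson order_trans)
qed

text \<open>Abhyankar's inequality for the seminorms \<^const>\<open>eval_norm\<close>. In the induction step a linear
  change of variables makes the last series regular, and a rescaling makes its leading
  coefficient a unit.\<close>

lemma scales_bounded:
  fixes u :: "nat \<Rightarrow> 'k::nonarch_valued_field series"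
  assumes inf: "infinite (UNIV :: 'k set)" and nontriv: "\<exists>x::'k. x \<noteq> 0 \<and> vabs x \<noteq> 1"
    and "\<And>j. u j \<in> int_series d" and "u d \<noteq> 0"
  shows "scales_bounded d u"
  using assms(3,4)
proof (induction d arbitrary: u)
  case 0
  have nth: "\<exists>c. fps_nth (u 0) j = (\<lambda>_. c) \<and> (j > 0 \<longrightarrow> c = 0)" for j
    using 0 by (intro hom_fun_0 int_series_nth)
  then obtain c where c: "fps_nth (u 0) 0 = (\<lambda>_. c)" by blast
  have "u 0 = fps_const (\<lambda>_. c)"
    using nth by (auto simp: fps_eq_iff c fps_const_def zero_fun_def)
  with \<open>u 0 \<noteq> 0\<close> have "c \<noteq> 0"
    by (auto simp: zero_fun_def[symmetric])
  then obtain N where "(1 / 2) ^ N < vabs c"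
    using real_arch_pow_inv[of "vabs c" "1 / 2"] by (auto simp: vabs_pos_iff)
  then show ?case
    unfolding scales_bounded_def lacunary_def \<open>u 0 = _\<close> eval_norm_const
    by (intro exI[of _ N]) (simp add: not_le)
next
  case (Suc d)
  define n where "n = (LEAST n. fps_nth (u (Suc d)) n \<noteq> 0)"
  have "\<exists>n. fps_nth (u (Suc d)) n \<noteq> 0"
    using Suc.prems(2) by (simp add: fps_eq_iff)
  then have n: "fps_nth (u (Suc d)) n \<noteq> 0" and below: "\<And>k. k < n \<Longrightarrow> fps_nth (u (Suc d)) k = 0"
    unfolding n_def by (rule LeastI_ex) (use not_less_Least in blast)
  obtain c where c: "c d = 1" "fps_nth (u (Suc d)) n c \<noteq> 0"
    using hom_fun_regular_direction[OF inf int_series_nth[OF Suc.prems(1)] n] by blast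
  obtain b where b: "b \<noteq> 0" "vabs b \<le> 1" "\<And>i. i < Suc d \<Longrightarrow> vabs (b * c i) \<le> 1"
    using exists_common_small[OF nontriv, of "Suc d" c] by blast
  \<comment> \<open>\<open>L\<close> maps the last basis vector to \<open>b * c\<close>, a direction
    in which the lowest form does not vanish, so the last series becomes regular of order
    \<open>n\<close> in \<open>h d\<close>. The factor \<open>b\<close> keeps the matrix
    integral.\<close>
  define L where "L h i = b * (if i < d then h i else 0) + b * c i * h d" for h i
  define M where "M h i = (if i < d then h i - c i * h d else h d) / b" for h i
  have L_hom: "hom_fun (Suc d) 1 (\<lambda>h. L h i)" if "i < Suc d" for i
  proof (cases "i < d")
    case True
    then show ?thesis
      using hom_fun.add[OF hom_fun_scale[OF b(2) hom_fun_var[of i "Suc d"]]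
          hom_fun_scale[OF b(3)[OF that] hom_fun_var[of d "Suc d"]]]
      by (simp add: L_def plus_fun_def)
  next
    case False
    then show ?thesis
      using hom_fun_scale[OF b(3)[OF that] hom_fun_var[of d "Suc d"]] by (simp add: L_def)
  qed
  define u1 where "u1 j = subst_series L (u j)" for j
  have u1: "u1 j \<in> int_series (Suc d)" for j
    unfolding u1_def by (intro int_series_subst[of "Suc d"] L_hom Suc.prems(1))
  obtain G where G: "\<And>k. fps_nth G k \<in> int_series d" "u1 (Suc d) = collapse (coord d) G"
    using int_series_Suc_collapse[OF u1] by blast
  define p :: "nat \<Rightarrow> 'k" where "p i = (if i = d then 1 else 0)" for i
  \<comment> \<open>At the last basis vector \<open>p\<close> only pure powers of the last variable
    survive, so the degree-\<open>k\<close> form there is the constant term of the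
    \<open>k\<close>-th coefficient of \<open>G\<close>.\<close>
  have G0: "fps_nth (fps_nth G k) 0 p = b ^ k * fps_nth (u (Suc d)) k c" for k
  proof -
    have vanish: "fps_nth (fps_nth G l) (k - l) p = 0" if "l < k" for l
    proof -
      have "vabs (fps_nth (fps_nth G l) (k - l) p) \<le> 0 ^ (k - l)"
        by (rule hom_fun_bound[OF int_series_nth[OF G(1)]]) (auto simp: p_def)
      moreover have "(0 :: real) ^ (k - l) = 0" using that by simp
      ultimately show ?thesis
        by (metis antisym vabs_eq_0_iff vabs_nonneg)
    qed
    have "fps_nth (u1 (Suc d)) k p = (\<Sum>l\<le>k. fps_nth (fps_nth G l) (k - l) p)"
      by (simp add: G(2) collapse_def sum_fun_apply power_fun_apply coord_def p_def)
    also have "\<dots> = (\<Sum>l\<in>{k}. fps_nth (fps_nth G l) (k - l) p)"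
      by (rule sum.mono_neutral_right) (auto simp: vanish)
    finally have "fps_nth (fps_nth G k) 0 p = fps_nth (u (Suc d)) k (L p)"
      by (simp add: u1_def subst_series_def)
    also have "\<dots> = fps_nth (u (Suc d)) k (\<lambda>i. b * c i)"
      by (rule hom_fun_cong[OF int_series_nth[OF Suc.prems(1)]]) (simp add: L_def p_def)
    also have "\<dots> = b ^ k * fps_nth (u (Suc d)) k c"
      by (rule hom_fun_scale_arg[OF int_series_nth[OF Suc.prems(1)]])
    finally show ?thesis .
  qed
  define g where "g = b ^ n * fps_nth (u (Suc d)) n c"
  have G0_const: "\<exists>c. fps_nth (fps_nth G k) 0 = (\<lambda>_. c) \<and> vabs c \<le> 1" for k
    by (rule hom_fun_degree_0[OF int_series_nth[OF G(1)]])
  have G_n: "fps_nth (fps_nth G n) 0 = (\<lambda>_. g)" and g: "g \<noteq> 0" "vabs g \<le> 1"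
    using G0_const[of n] G0[of n] b(1) c(2) by (auto simp: g_def)
  have G_low: "fps_nth (fps_nth G k) 0 = 0" if "k < n" for k
    using G0_const[of k] G0[of k] below[OF that] by (auto simp: zero_fun_def)
  \<comment> \<open>A monomial of degree \<open>k\<close> in the last variable and \<open>j\<close>
    in the others gains \<open>g ^ (k + Suc n * j)\<close>. The terms with \<open>j = 0\<close>,
    \<open>k < n\<close> are absent and the one with \<open>j = 0\<close>, \<open>k = n\<close>
    carries its own factor \<open>g\<close>, so everything becomes divisible by
    \<open>g ^ Suc n\<close>, with quotient 1 at the leading term.\<close>
  define L' where "L' h i = (if i < d then g ^ Suc n * h i else g * h d)" for h i
  define M' where "M' h i = (if i < d then h i / g ^ Suc n else h d / g)" for h i
  have L'_hom: "hom_fun (Suc d) 1 (\<lambda>h. L' h i)" if "i < Suc d" for i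
  proof -
    have "vabs (g ^ Suc n) \<le> 1"
      using g(2) by (simp add: vabs_mult vabs_power mult_le_one power_le_one vabs_nonneg)
    from hom_fun_scale[OF this hom_fun_var[OF that]] hom_fun_scale[OF g(2) hom_fun_var[of d "Suc d"]]
    show ?thesis
      by (cases "i < d") (simp_all add: L'_def)
  qed
  define u2 where "u2 j = subst_series L' (u1 j)" for j
  have u2: "u2 j \<in> int_series (Suc d)" for j
    unfolding u2_def by (intro int_series_subst[of "Suc d"] L'_hom u1)
  \<comment> \<open>For \<open>j = 0\<close>, \<open>k \<le> n\<close> the exponent would be cut off
    at 0 by subtraction of naturals, so these coefficients are prescribed separately.\<close>
  define G' where "G' = Abs_fps (\<lambda>k. Abs_fps (\<lambda>j. if j = 0 \<and> k \<le> n then (if k = n then 1 else 0)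
      else (\<lambda>h. g ^ (k + Suc n * j - Suc n) * fps_nth (fps_nth G k) j h)))"
  have G': "fps_nth G' k \<in> int_series d" for k
  proof -
    have "vabs (g ^ m) \<le> 1" for m
      using g(2) by (simp add: vabs_power power_le_one vabs_nonneg)
    then show ?thesis
      by (auto simp: int_series_def G'_def intro!: hom_fun_one hom_fun.zero hom_fun_scale
          int_series_nth[OF G(1)])
  qed
  have "u2 (Suc d) = fps_const (\<lambda>_. g ^ Suc n) * collapse (coord d) G'"
  proof (rule fps_ext, rule ext)
    fix N h
    have summand: "(g * h d) ^ k * fps_nth (fps_nth G k) j (L' h)
        = g ^ Suc n * (h d ^ k * fps_nth (fps_nth G' k) j h)" for k j
    proof -
      have "fps_nth (fps_nth G k) j (L' h) = fps_nth (fps_nth G k) j (\<lambda>i. g ^ Suc n * h i)"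
        by (rule hom_fun_cong[OF int_series_nth[OF G(1)]]) (simp add: L'_def)
      also have "\<dots> = (g ^ Suc n) ^ j * fps_nth (fps_nth G k) j h"
        by (rule hom_fun_scale_arg[OF int_series_nth[OF G(1)]])
      finally have "(g * h d) ^ k * fps_nth (fps_nth G k) j (L' h)
          = h d ^ k * (g ^ (k + Suc n * j) * fps_nth (fps_nth G k) j h)"
        by (simp only: power_mult_distrib power_add power_mult) (simp only: mult_ac)
      also have "g ^ (k + Suc n * j) * fps_nth (fps_nth G k) j h = g ^ Suc n * fps_nth (fps_nth G' k) j h"
      proof (cases "j = 0 \<and> k \<le> n")
        case True
        then show ?thesis
          by (cases "k = n") (auto simp: G'_def G_n G_low)
      next
        case False
        have "Suc n \<le> k + Suc n * j"
        proof (cases j)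
          case 0
          then show ?thesis using False by simp
        next
          case (Suc i)
          then show ?thesis by simp
        qed
        then have "g ^ (k + Suc n * j) = g ^ Suc n * g ^ (k + Suc n * j - Suc n)"
          by (simp only: power_add[symmetric] le_add_diff_inverse)
        then show ?thesis
          using False by (simp only: G'_def fps_nth_Abs_fps if_False mult.assoc)
      qed
      finally show ?thesis by (simp only: mult_ac)
    qed
    have "fps_nth (u2 (Suc d)) N h = (\<Sum>k\<le>N. (g * h d) ^ k * fps_nth (fps_nth G k) (N - k) (L' h))"
      by (simp add: u2_def subst_series_def G(2) collapse_def sum_fun_apply power_fun_apply coord_def L'_def)
    also have "\<dots> = (\<Sum>k\<le>N. g ^ Suc n * (h d ^ k * fps_nth (fps_nth G' k) (N - k) h))"
      by (simp only: summand)
    also have "\<dots> = fps_nth (fps_const (\<lambda>_. g ^ Suc n) * collapse (coord d) G') N h"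
      by (simp add: collapse_def sum_fun_apply power_fun_apply coord_def sum_distrib_left)
    finally show "fps_nth (u2 (Suc d)) N h = fps_nth (fps_const (\<lambda>_. g ^ Suc n) * collapse (coord d) G') N h" .
  qed
  moreover have "scales_bounded (Suc d) (u2(Suc d := collapse (coord d) G'))"
  proof (rule scales_bounded_regular[where G = G' and K = n, OF Suc.IH])
    show "(u2(Suc d := collapse (coord d) G')) j \<in> int_series (Suc d)" for j
      using u2 collapse_int_series[OF G'] by simp
    show "fps_nth G' k \<in> int_series d" for k
      by (rule G')
  qed (auto simp: G'_def)
  moreover have "g ^ Suc n \<noteq> 0" "vabs (g ^ Suc n) \<le> 1"
    using g by (simp_all add: vabs_mult vabs_power mult_le_one power_le_one vabs_nonneg)
  ultimately have "scales_bounded (Suc d) u2"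
    using scales_bounded_const_mult[OF collapse_int_series[OF G']] by blast
  then have "scales_bounded (Suc d) u1"
    unfolding u2_def
  proof (rule scales_bounded_subst[where M = M' and e = "vabs (g ^ Suc n)", OF u1, rotated -1])
    show "L' (M' h) i = h i" if "i < Suc d" for h i
      using that g(1) by (auto simp: L'_def M'_def less_Suc_eq)
    show "0 < vabs (g ^ Suc n)" using g(1) by (simp add: vabs_pos_iff)
    show "vabs (M' h i) \<le> r"
      if "0 \<le> r" "\<forall>i<Suc d. vabs (h i) \<le> r * vabs (g ^ Suc n)" "i < Suc d" for h i and r :: real
    proof -
      have le: "vabs (g ^ Suc n) \<le> vabs g"
        using g(2) by (simp add: vabs_mult vabs_power mult_left_le power_le_one vabs_nonneg)
      have "0 < vabs g" "0 < vabs (g ^ Suc n)" using g(1) by (simp_all add: vabs_pos_iff)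
      moreover have "vabs (h i) \<le> r * vabs (g ^ Suc n)" "vabs (h d) \<le> r * vabs g"
        using that order_trans[OF _ mult_left_mono[OF le that(1)]] by auto
      ultimately show ?thesis
        by (simp only: M'_def vabs_divide pos_divide_le_eq simp_thms split: if_split)
    qed
  qed
  \<comment> \<open>One factor \<open>vabs b\<close> pays for the division by \<open>b\<close>, the
    other for \<open>c i\<close>, about which only \<open>vabs (b * c i) \<le> 1\<close> is
    known.\<close>
  then show ?case
    unfolding u1_def
  proof (rule scales_bounded_subst[where M = M and e = "vabs b * vabs b", OF Suc.prems(1), rotated -1])
    show "L (M h) i = h i" if "i < Suc d" for h i
      using that b(1) c(1) by (auto simp: L_def M_def less_Suc_eq field_simps)
    show "0 < vabs b * vabs b" using b(1) by (simp add: vabs_pos_iff)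
    show "vabs (M h i) \<le> r"
      if r: "0 \<le> r" and h: "\<forall>i<Suc d. vabs (h i) \<le> r * (vabs b * vabs b)" and i: "i < Suc d"
      for h i and r :: real
    proof -
      have pos: "0 < vabs b" using b(1) by (simp add: vabs_pos_iff)
      have "r * vabs b * vabs b \<le> r * vabs b"
        using b(2) r pos by (simp add: mult_left_le)
      then have le: "vabs (h i) \<le> r * vabs b" if "i < Suc d" for i
        using h that by (force simp: mult.assoc)
      have "vabs b * vabs (c i * h d) = vabs (b * c i) * vabs (h d)"
        by (simp add: vabs_mult)
      also have "\<dots> \<le> vabs (h d)"
        using b(3)[OF i] by (simp add: mult_left_le_one_le vabs_nonneg)
      also have "\<dots> \<le> r * (vabs b * vabs b)"
        using h by simp
      finally have "vabs b * vabs (c i * h d) \<le> vabs b * (r * vabs b)"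
        by (simp add: mult_ac)
      then have "vabs (c i * h d) \<le> r * vabs b"
        using pos by simp
      then have "vabs (h i - c i * h d) \<le> r * vabs b" "vabs (h d) \<le> r * vabs b"
        using vabs_diff_le_max[of "h i" "c i * h d"] le[OF i] le[of d] by auto
      then show ?thesis
        using pos by (simp only: M_def vabs_divide pos_divide_le_eq simp_thms split: if_split)
    qed
  qed
qed

section \<open>Locally constant functions are smooth\<close>

definition locally_constant_on :: "'a::topological_space set \<Rightarrow> ('a \<Rightarrow> 'b) \<Rightarrow> bool" where
  "locally_constant_on S f \<longleftrightarrow> (\<forall>x\<in>S. \<exists>U. open U \<and> x \<in> U \<and> (\<forall>y\<in>S \<inter> U. f y = f x))"

lemma locally_constant_on_eventually:
  assumes "locally_constant_on S f" and "x \<in> S"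
  shows "\<forall>\<^sub>F y in at x within S. f y = f x"
proof -
  obtain U where "open U" "x \<in> U" "\<forall>y\<in>S \<inter> U. f y = f x"
    using assms unfolding locally_constant_on_def by blast
  then show ?thesis
    unfolding eventually_at_topological by (intro exI[of _ U]) simp
qed

lemma locally_constant_on_imp_continuous:
  fixes f :: "'a::topological_space \<Rightarrow> 'b::topological_space"
  assumes "locally_constant_on S f"
  shows "continuous_on S f"
  unfolding continuous_on_def
proof
  fix x assume "x \<in> S"
  show "(f \<longlongrightarrow> f x) (at x within S)"
    by (rule tendsto_eventually) (rule locally_constant_on_eventually[OF assms \<open>x \<in> S\<close>])
qed

lemma locally_constant_on_subset:
  assumes "locally_constant_on S f" and "T \<subseteq> S"
  shows "locally_constant_on T f"
  unfolding locally_constant_on_def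
proof
  fix x assume "x \<in> T"
  then obtain U where "open U" "x \<in> U" "\<forall>y\<in>S \<inter> U. f y = f x"
    using assms unfolding locally_constant_on_def by blast
  then show "\<exists>U. open U \<and> x \<in> U \<and> (\<forall>y\<in>T \<inter> U. f y = f x)"
    using assms(2) by (intro exI[of _ U]) auto
qed

lemma locally_constant_on_compose:
  assumes f: "locally_constant_on T f" and g: "continuous_on S g" "g \<in> S \<rightarrow> T"
  shows "locally_constant_on S (\<lambda>x. f (g x))"
  unfolding locally_constant_on_def
proof
  fix x assume "x \<in> S"
  then have "g x \<in> T" using g(2) by blast
  then obtain U where U: "open U" "g x \<in> U" "\<forall>y\<in>T \<inter> U. f y = f (g x)"
    using f unfolding locally_constant_on_def by blast
  obtain V where "open V" "V \<inter> S = g -` U \<inter> S"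
    using g(1) U(1) by (auto simp: continuous_on_open_invariant)
  then show "\<exists>V. open V \<and> x \<in> V \<and> (\<forall>y\<in>S \<inter> V. f (g y) = f (g x))"
    using U \<open>x \<in> S\<close> g(2) by (intro exI[of _ V]) blast
qed

lemma locally_constant_on_binary:
  assumes "locally_constant_on S f" and "locally_constant_on S g"
  shows "locally_constant_on S (\<lambda>x. F (f x) (g x))"
  unfolding locally_constant_on_def
proof
  fix x assume "x \<in> S"
  then obtain U V where "open U" "x \<in> U" "\<forall>y\<in>S \<inter> U. f y = f x" "open V" "x \<in> V" "\<forall>y\<in>S \<inter> V. g y = g x"
    using assms unfolding locally_constant_on_def by meson
  then show "\<exists>W. open W \<and> x \<in> W \<and> (\<forall>y\<in>S \<inter> W. F (f y) (g y) = F (f x) (g x))"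
    by (intro exI[of _ "U \<inter> V"]) auto
qed

text \<open>An open set of the product topology restricts only finitely many coordinates, which is
  enough because points of \<open>Kpow d\<close> have just \<open>d\<close> of them.\<close>

lemma locally_constant_on_Kpow:
  fixes f :: "(nat \<Rightarrow> 'k::nonarch_valued_field) \<Rightarrow> 'b"
  assumes "\<And>a. a \<in> Kpow d \<Longrightarrow>
    \<exists>e>0. \<forall>x\<in>Kpow d. (\<forall>i<d. vabs (x i - a i) < e) \<longrightarrow> f x = f a"
  shows "locally_constant_on (Kpow d) f"
  unfolding locally_constant_on_def
proof
  fix a :: "nat \<Rightarrow> 'k" assume "a \<in> Kpow d"
  then obtain e where e: "e > 0" "\<forall>x\<in>Kpow d. (\<forall>i<d. vabs (x i - a i) < e) \<longrightarrow> f x = f a"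
    using assms by blast
  let ?U = "\<Inter>i\<in>{..<d}. (\<lambda>x. x i) -` ball (a i) e"
  have "open ?U"
    by (intro open_INT ballI open_vimage open_ball continuous_on_product_coordinates) simp
  moreover have "vabs (x i - a i) < e" if "x \<in> ?U" "i < d" for x i
    using that vabs_minus[of "x i - a i"] by (auto simp: dist_vabs dest!: bspec[of _ _ i])
  ultimately show "\<exists>U. open U \<and> a \<in> U \<and> (\<forall>y\<in>Kpow d \<inter> U. f y = f a)"
    using e by (intro exI[of _ ?U]) auto
qed

section \<open>Continuity of the field operations\<close>

lemma tendsto_mult_valued:
  fixes f g :: "'a \<Rightarrow> 'k::nonarch_valued_field"
  assumes "(f \<longlongrightarrow> a) F" and "(g \<longlongrightarrow> b) F"
  shows "((\<lambda>x. f x * g x) \<longlongrightarrow> a * b) F"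
proof (rule tendstoI)
  fix e :: real assume "0 < e"
  define c where "c = 1 + vabs a + vabs b"
  have "1 \<le> c" using vabs_nonneg[of a] vabs_nonneg[of b] by (simp add: c_def)
  define r where "r = min 1 (e / c)"
  have "0 < r" using \<open>0 < e\<close> \<open>1 \<le> c\<close> by (simp add: r_def)
  have "\<forall>\<^sub>F x in F. dist (f x) a < r \<and> dist (g x) b < r"
    using assms \<open>0 < r\<close> by (auto simp: tendsto_iff intro: eventually_conj)
  then show "\<forall>\<^sub>F x in F. dist (f x * g x) (a * b) < e"
  proof (rule eventually_mono)
    fix x assume x: "dist (f x) a < r \<and> dist (g x) b < r"
    define p q where "p = f x - a" and "q = g x - b"
    have pq: "vabs p < r" "vabs q < r" using x by (auto simp: p_def q_def dist_vabs)
    have "f x * g x - a * b = p * q + (p * b + a * q)"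
      by (simp add: p_def q_def algebra_simps)
    then have "vabs (f x * g x - a * b) \<le> vabs (p * q) + (vabs (p * b) + vabs (a * q))"
      using vabs_triangle[of "p * q" "p * b + a * q"] vabs_triangle[of "p * b" "a * q"] by simp
    also have "\<dots> = vabs p * vabs q + vabs p * vabs b + vabs a * vabs q"
      by (simp add: vabs_mult)
    also have "\<dots> < r * 1 + r * vabs b + vabs a * r"
    proof -
      have "vabs p * vabs q < r * 1"
        using pq vabs_nonneg[of p] vabs_nonneg[of q] by (intro mult_strict_mono') (auto simp: r_def)
      moreover have "vabs p * vabs b \<le> r * vabs b" "vabs a * vabs q \<le> vabs a * r"
        using pq by (auto intro!: mult_right_mono mult_left_mono vabs_nonneg)
      ultimately show ?thesis by linarith
    qed
    also have "\<dots> = r * c" by (simp add: c_def algebra_simps)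
    also have "\<dots> \<le> e" using \<open>1 \<le> c\<close> by (simp add: r_def min_def field_simps)
    finally show "dist (f x * g x) (a * b) < e" by (simp add: dist_vabs)
  qed
qed

lemma tendsto_divide_valued:
  fixes f :: "'a \<Rightarrow> 'k::nonarch_valued_field"
  assumes "(f \<longlongrightarrow> a) F" and "a \<noteq> 0"
  shows "((\<lambda>x. c / f x) \<longlongrightarrow> c / a) F"
proof -
  have "((\<lambda>x. 1 / f x) \<longlongrightarrow> 1 / a) F"
  proof (rule tendstoI)
    fix e :: real assume "0 < e"
    have a: "0 < vabs a" using assms(2) by (simp add: vabs_pos_iff)
    have "\<forall>\<^sub>F x in F. dist (f x) a < min (vabs a) (e * (vabs a * vabs a))"
      using assms(1) a \<open>0 < e\<close> by (intro tendstoD) auto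
    then show "\<forall>\<^sub>F x in F. dist (1 / f x) (1 / a) < e"
    proof (rule eventually_mono)
      fix x assume x: "dist (f x) a < min (vabs a) (e * (vabs a * vabs a))"
      \<comment> \<open>The absolute value is constant near \<open>a\<close>, so the denominator of
        the difference is exactly \<open>vabs a * vabs a\<close>.\<close>
      then have eq: "vabs (f x) = vabs a" by (intro vabs_eq_of_near) (simp add: dist_vabs)
      then have "f x \<noteq> 0" using a by auto
      then have "1 / f x - 1 / a = - (f x - a) / (f x * a)"
        using assms(2) by (simp add: field_simps)
      then have "dist (1 / f x) (1 / a) = dist (f x) a / (vabs a * vabs a)"
        by (simp only: dist_vabs vabs_divide vabs_minus vabs_mult eq)
      also have "\<dots> < e"
        using x a by (simp add: divide_less_eq)
      finally show "dist (1 / f x) (1 / a) < e" .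
    qed
  qed
  from tendsto_mult_valued[OF tendsto_const this] show ?thesis by simp
qed

lemma tendsto_prod_valued:
  fixes f :: "'i \<Rightarrow> 'a \<Rightarrow> 'k::nonarch_valued_field"
  assumes "\<And>i. i \<in> A \<Longrightarrow> (f i \<longlongrightarrow> a i) F"
  shows "((\<lambda>x. \<Prod>i\<in>A. f i x) \<longlongrightarrow> (\<Prod>i\<in>A. a i)) F"
  using assms
proof (induction A rule: infinite_finite_induct)
  case (insert i A)
  then have "((\<lambda>x. f i x * (\<Prod>i\<in>A. f i x)) \<longlongrightarrow> a i * (\<Prod>i\<in>A. a i)) F"
    by (intro tendsto_mult_valued) auto
  then show ?case using insert.hyps by simp
qed simp_all

section \<open>Difference quotients of locally constant functions\<close>

primrec iterated_diff ::
  "nat \<Rightarrow> ((nat \<Rightarrow> 'k::nonarch_valued_field) \<Rightarrow> 'k) \<Rightarrow>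
   (nat \<Rightarrow> 'k) \<Rightarrow> (nat \<Rightarrow> nat \<Rightarrow> 'k) \<Rightarrow> (nat \<Rightarrow> 'k) \<Rightarrow> 'k" where
  "iterated_diff 0 f x v t = f x"
| "iterated_diff (Suc n) f x v t =
     iterated_diff n f (\<lambda>i. x i + t n * v n i) v t - iterated_diff n f x v t"

lemma Phi_eq_iterated_diff: "Phi n f x v t = iterated_diff n f x v t / (\<Prod>i<n. t i)"
proof (induction n arbitrary: x)
  case (Suc n)
  have "Phi (Suc n) f x v t = (iterated_diff n f (\<lambda>i. x i + t n * v n i) v t / (\<Prod>i<n. t i)
      - iterated_diff n f x v t / (\<Prod>i<n. t i)) / t n"
    by (simp only: Phi.simps diff_quot_def Suc)
  also have "\<dots> = iterated_diff (Suc n) f x v t / ((\<Prod>i<n. t i) * t n)"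
    by (simp only: diff_divide_distrib[symmetric] divide_divide_eq_left iterated_diff.simps)
  finally show ?case by simp
qed simp

text \<open>A zero increment makes two translates coincide. The numerator of \<open>Phi\<close>
  therefore vanishes wherever its denominator does.\<close>

lemma iterated_diff_eq_0: "i < n \<Longrightarrow> t i = 0 \<Longrightarrow> iterated_diff n f x v t = 0"
proof (induction n arbitrary: x)
  case (Suc n)
  then show ?case by (cases "i = n") simp_all
qed simp

text \<open>All directions are asked to lie in \<open>Kpow d\<close> and the increments are
  arbitrary, so that the domain does not depend on \<open>n\<close> and translation by
  \<open>t n * v n\<close> maps it into itself.\<close>

lemma locally_constant_on_iterated_diff:
  fixes f :: "(nat \<Rightarrow> 'k::nonarch_valued_field) \<Rightarrow> 'k"
  assumes "locally_constant_on (Kpow d) f"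
  shows "locally_constant_on (Kpow d \<times> {v. \<forall>i. v i \<in> Kpow d} \<times> UNIV) (\<lambda>(x, v, t). iterated_diff n f x v t)"
    (is "locally_constant_on ?S _")
proof (induction n)
  case 0
  have "locally_constant_on ?S (\<lambda>z. f (fst z))"
    by (rule locally_constant_on_compose[OF assms]) (auto intro: continuous_on_fst continuous_on_id)
  then show ?case by (simp add: case_prod_unfold)
next
  case (Suc n)
  let ?T = "\<lambda>z. ((\<lambda>i. fst z i + snd (snd z) n * fst (snd z) n i), snd z)"
  have coord: "continuous_on ?S (\<lambda>z. fst z i)" "continuous_on ?S (\<lambda>z. snd (snd z) n)"
    "continuous_on ?S (\<lambda>z. fst (snd z) n i)" for i
    by (rule continuous_on_product_then_coordinatewise[OF continuous_on_fst[OF continuous_on_id]]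
        continuous_on_product_then_coordinatewise[OF continuous_on_snd[OF continuous_on_snd[OF continuous_on_id]]]
        continuous_on_product_then_coordinatewise[OF continuous_on_product_then_coordinatewise[OF
          continuous_on_fst[OF continuous_on_snd[OF continuous_on_id]]]])+
  have "continuous_on ?S (\<lambda>z. fst z i + snd (snd z) n * fst (snd z) n i)" for i
    using coord(1)[of i] coord(2) coord(3)[of i] unfolding continuous_on_def by (intro ballI tendsto_add tendsto_mult_valued) blast+
  then have "continuous_on ?S ?T"
    by (intro continuous_on_Pair continuous_on_coordinatewise_then_product continuous_on_snd continuous_on_id)
  moreover have "?T \<in> ?S \<rightarrow> ?S"
    by (auto simp: Kpow_def)
  ultimately have "locally_constant_on ?S (\<lambda>z. (\<lambda>(x, v, t). iterated_diff n f x v t) (?T z))"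
    by (rule locally_constant_on_compose[OF Suc])
  from locally_constant_on_binary[OF this Suc, of "(-)"] show ?case
    by (simp add: case_prod_unfold)
qed

text \<open>The numerator is locally constant on all of \<open>Xn d k\<close> and zero where some
  increment is zero. Near such a point the quotient is constantly 0, which agrees with the value of
  division by zero, so \<open>Phi k f\<close> is its own continuous extension.\<close>

lemma locally_constant_imp_C_infinity:
  fixes f :: "(nat \<Rightarrow> 'k::nonarch_valued_field) \<Rightarrow> 'k"
  assumes "locally_constant_on (Kpow d) f"
  shows "f \<in> C_infinity d"
proof -
  have cont: "continuous_on (Xn d k) (\<lambda>(x, v, t). Phi k f x v t)" for k
  proof -
    let ?S = "Xn d k :: ((nat \<Rightarrow> 'k) \<times> (nat \<Rightarrow> nat \<Rightarrow> 'k) \<times> (nat \<Rightarrow> 'k)) set"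
    let ?D = "\<lambda>z. iterated_diff k f (fst z) (fst (snd z)) (snd (snd z))"
    let ?p = "\<lambda>z :: (nat \<Rightarrow> 'k) \<times> (nat \<Rightarrow> nat \<Rightarrow> 'k) \<times> (nat \<Rightarrow> 'k). \<Prod>i<k. snd (snd z) i"
    have "v i \<in> Kpow d" if "\<forall>i<k. v i \<in> Kpow d" "\<forall>i\<ge>k. v i = (\<lambda>_. 0)" for v :: "nat \<Rightarrow> nat \<Rightarrow> 'k" and i
      using that by (cases "i < k") (auto simp: Kpow_def)
    then have "?S \<subseteq> Kpow d \<times> {v. \<forall>i. v i \<in> Kpow d} \<times> UNIV"
      by (auto simp: Xn_def)
    from locally_constant_on_subset[OF locally_constant_on_iterated_diff[OF assms, of k] this]
    have D: "locally_constant_on ?S ?D"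
      by (simp add: case_prod_unfold)
    have "((\<lambda>z. ?D z / ?p z) \<longlongrightarrow> ?D z / ?p z) (at z within ?S)" if "z \<in> ?S" for z
    proof -
      have ev: "\<forall>\<^sub>F w in at z within ?S. ?D w = ?D z"
        by (rule locally_constant_on_eventually[OF D that])
      have "((\<lambda>w. ?D z / ?p w) \<longlongrightarrow> ?D z / ?p z) (at z within ?S)"
      proof (cases "?p z = 0")
        case True
        then obtain i where "i < k" "snd (snd z) i = 0"
          by (auto simp: prod_zero_iff)
        then have "?D z = 0" by (rule iterated_diff_eq_0)
        then show ?thesis by (simp only: div_0 tendsto_const)
      next
        case False
        have "continuous_on ?S (\<lambda>w. snd (snd w) i)" for i
          by (rule continuous_on_product_then_coordinatewise[OF continuous_on_snd[OF continuous_on_snd[OF continuous_on_id]]])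
        then have "((\<lambda>w. snd (snd w) i) \<longlongrightarrow> snd (snd z) i) (at z within ?S)" for i
          using that by (auto simp: continuous_on_def)
        then show ?thesis
          by (intro tendsto_divide_valued tendsto_prod_valued False)
      qed
      moreover have "\<forall>\<^sub>F w in at z within ?S. ?D z / ?p w = ?D w / ?p w"
        using ev by (rule eventually_mono) simp
      ultimately show ?thesis
        by (rule Lim_transform_eventually)
    qed
    then have "continuous_on ?S (\<lambda>z. ?D z / ?p z)"
      by (auto simp: continuous_on_def)
    then show ?thesis
      by (simp add: case_prod_unfold Phi_eq_iterated_diff)
  qed
  have "f \<in> C_space n d" for n
    unfolding C_space_def
  proof (intro CollectI conjI ballI)
    show "continuous_on (Kpow d) f"
      by (rule locally_constant_on_imp_continuous[OF assms])
    show "\<exists>g. continuous_on (Xn d k) g \<and>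
        (\<forall>(x, v, t)\<in>Xn d k. (\<forall>i<k. t i \<noteq> 0) \<longrightarrow> g (x, v, t) = Phi k f x v t)" for k
      using cont[of k] by (intro exI[of _ "\<lambda>(x, v, t). Phi k f x v t"] conjI) auto
  qed
  then show ?thesis
    by (simp add: C_infinity_def)
qed

section \<open>Normalised expansions of locally analytic maps\<close>

definition total_degree :: "nat \<Rightarrow> (nat \<Rightarrow> nat) \<Rightarrow> nat" where
  "total_degree d \<alpha> = (\<Sum>i<d. \<alpha> i)"

lemma finite_multi_indices_le: "finite {\<alpha> \<in> multi_indices d. total_degree d \<alpha> \<le> n}"
proof (rule finite_subset)
  show "{\<alpha> \<in> multi_indices d. total_degree d \<alpha> \<le> n}
      \<subseteq> {\<alpha>. \<forall>i. (i \<in> {..<d} \<longrightarrow> \<alpha> i \<in> {..n}) \<and> (i \<notin> {..<d} \<longrightarrow> \<alpha> i = 0)}"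
  proof (intro subsetI CollectI conjI allI impI)
    fix \<alpha> i assume \<alpha>: "\<alpha> \<in> {\<alpha> \<in> multi_indices d. total_degree d \<alpha> \<le> n}"
    show "\<alpha> i = 0" if "i \<notin> {..<d}" using \<alpha> that by (simp add: multi_indices_def)
    assume "i \<in> {..<d}"
    then have "\<alpha> i \<le> (\<Sum>i<d. \<alpha> i)" by (intro member_le_sum) auto
    then show "\<alpha> i \<in> {..n}" using \<alpha> by (simp add: total_degree_def)
  qed
qed (rule finite_set_of_finite_funs; simp)

lemma total_degree_eq_0: "\<alpha> \<in> multi_indices d \<Longrightarrow> total_degree d \<alpha> = 0 \<Longrightarrow> \<alpha> = (\<lambda>_. 0)"
proof (rule ext)
  fix i assume "\<alpha> \<in> multi_indices d" "total_degree d \<alpha> = 0"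
  then show "\<alpha> i = 0"
    by (cases "i < d") (simp_all add: multi_indices_def total_degree_def)
qed

lemma hom_fun_monomial: "n \<le> d \<Longrightarrow> hom_fun d (total_degree n \<alpha>) (\<lambda>h :: nat \<Rightarrow> 'k::nonarch_valued_field. \<Prod>i<n. h i ^ \<alpha> i)"
proof (induction n)
  case 0
  show ?case using hom_fun_one[of d] by (simp add: total_degree_def one_fun_def)
next
  case (Suc n)
  have "hom_fun d (total_degree n \<alpha> + \<alpha> n * 1) ((\<lambda>h :: nat \<Rightarrow> 'k. \<Prod>i<n. h i ^ \<alpha> i) * (\<lambda>h. h n) ^ \<alpha> n)"
    using Suc by (intro hom_fun_mult hom_fun_power hom_fun_var) auto
  moreover have "(\<lambda>h :: nat \<Rightarrow> 'k. \<Prod>i<n. h i ^ \<alpha> i) * (\<lambda>h. h n) ^ \<alpha> n = (\<lambda>h. \<Prod>i<Suc n. h i ^ \<alpha> i)"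
    by (rule ext) (simp only: times_fun_apply power_fun_apply prod.lessThan_Suc)
  ultimately show ?case by (simp add: total_degree_def)
qed

text \<open>Adding one index to a finite set whose sum is already near \<open>s\<close> changes that
  sum by less than 1, by the ultrametric inequality; only finitely many other terms need a
  maximum.\<close>

lemma has_sum_terms_bounded:
  fixes f :: "'a \<Rightarrow> 'k::nonarch_valued_field"
  assumes "(f has_sum s) A"
  shows "\<exists>C\<ge>1. \<forall>x\<in>A. vabs (f x) \<le> C"
proof -
  have "\<forall>\<^sub>F X in finite_subsets_at_top A. dist (sum f X) s < 1"
    using assms unfolding has_sum_def by (rule tendstoD) simp
  then obtain X where "finite X \<and> X \<subseteq> A \<and> (\<forall>Y. finite Y \<and> X \<subseteq> Y \<and> Y \<subseteq> A \<longrightarrow> dist (sum f Y) s < 1)"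
    unfolding eventually_finite_subsets_at_top by (elim exE)
  then have X: "finite X" "X \<subseteq> A" "\<And>Y. finite Y \<Longrightarrow> X \<subseteq> Y \<Longrightarrow> Y \<subseteq> A \<Longrightarrow> dist (sum f Y) s < 1"
    by auto
  define C where "C = Max (insert 1 ((\<lambda>x. vabs (f x)) ` X))"
  have "1 \<le> C" unfolding C_def using X(1) by (intro Max_ge) auto
  moreover have "vabs (f x) \<le> C" if "x \<in> A" for x
  proof (cases "x \<in> X")
    case True
    then show ?thesis unfolding C_def using X(1) by (intro Max_ge) auto
  next
    case False
    have "dist (sum f X) s < 1" "dist (sum f (insert x X)) s < 1"
      using X(3)[of X] X(3)[of "insert x X"] X(1,2) that by (simp_all add: subset_insertI)
    then have "vabs ((sum f (insert x X) - s) - (sum f X - s)) < 1"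
      using vabs_diff_le_max[of "sum f (insert x X) - s" "sum f X - s"] by (simp only: dist_vabs)
    then have "vabs (f x) < 1" using False X(1) by simp
    then show ?thesis using \<open>1 \<le> C\<close> by simp
  qed
  ultimately show ?thesis by blast
qed

text \<open>The sets of multi-indices of total degree below \<open>n\<close> are finite and
  eventually contain every finite set, so unconditional convergence passes to summation by
  degree.\<close>

lemma has_sum_graded_partial_sums:
  fixes f :: "(nat \<Rightarrow> nat) \<Rightarrow> 'k::nonarch_valued_field"
  assumes "(f has_sum s) (multi_indices d)"
  shows "(\<lambda>n. \<Sum>j<n. \<Sum>\<alpha>\<in>{\<alpha> \<in> multi_indices d. total_degree d \<alpha> = j}. f \<alpha>) \<longlonglongrightarrow> s"
proof -
  let ?A = "\<lambda>n. {\<alpha> \<in> multi_indices d. total_degree d \<alpha> < n}"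
  have fin: "finite (?A n)" for n
    by (rule finite_subset[OF _ finite_multi_indices_le[of d n]]) auto
  have "filterlim ?A (finite_subsets_at_top (multi_indices d)) sequentially"
    unfolding filterlim_finite_subsets_at_top
  proof (intro allI impI)
    fix X assume X: "finite X \<and> X \<subseteq> multi_indices d"
    define m where "m = Suc (Max (insert 0 (total_degree d ` X)))"
    have "X \<subseteq> ?A n" if "n \<ge> m" for n
    proof
      fix \<alpha> assume "\<alpha> \<in> X"
      then have "total_degree d \<alpha> \<le> Max (insert 0 (total_degree d ` X))"
        using X \<open>\<alpha> \<in> X\<close> by (intro Max_ge) auto
      then have "total_degree d \<alpha> < m" by (simp only: m_def less_Suc_eq_le)
      then show "\<alpha> \<in> ?A n" using that X \<open>\<alpha> \<in> X\<close> by auto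
    qed
    then show "\<forall>\<^sub>F n in sequentially. finite (?A n) \<and> X \<subseteq> ?A n \<and> ?A n \<subseteq> multi_indices d"
      using fin by (auto simp: eventually_sequentially intro!: exI[of _ m])
  qed
  then have "(\<lambda>n. sum f (?A n)) \<longlonglongrightarrow> s"
    using assms unfolding has_sum_def by (rule filterlim_compose[rotated])
  moreover have "sum f (?A n) = (\<Sum>j<n. \<Sum>\<alpha>\<in>{\<alpha> \<in> multi_indices d. total_degree d \<alpha> = j}. f \<alpha>)" for n
  proof -
    have "(\<Sum>j<n. \<Sum>\<alpha>\<in>{\<alpha> \<in> ?A n. total_degree d \<alpha> = j}. f \<alpha>) = sum f (?A n)"
      by (rule sum.group) (use fin in auto)
    moreover have "{\<alpha> \<in> ?A n. total_degree d \<alpha> = j} = {\<alpha> \<in> multi_indices d. total_degree d \<alpha> = j}" if "j < n" for j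
      using that by auto
    ultimately show ?thesis by simp
  qed
  ultimately show ?thesis by simp
qed

lemma eval_norm_eqI:
  assumes "(\<lambda>n. trunc f h n) \<longlonglongrightarrow> s"
  shows "eval_norm h f = vabs s"
proof -
  have "(\<lambda>n. vabs (trunc f h n)) \<longlonglongrightarrow> vabs s"
  proof (rule metric_LIMSEQ_I)
    fix e :: real assume "0 < e"
    then obtain n0 where n0: "\<And>n. n \<ge> n0 \<Longrightarrow> dist (trunc f h n) s < e"
      using metric_LIMSEQ_D[OF assms] by blast
    have "dist (vabs (trunc f h n)) (vabs s) < e" if "n \<ge> n0" for n
      using n0[OF that] unfolding dist_vabs dist_real_def by (rule le_less_trans[OF abs_vabs_diff_le])
    then show "\<exists>n0. \<forall>n\<ge>n0. dist (vabs (trunc f h n)) (vabs s) < e"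
      by blast
  qed
  then show ?thesis unfolding eval_norm_def by (rule limI)
qed

text \<open>Every term of degree at least 1 is at most \<open>r\<close>. This supplies the
  continuity of an analytic map at the centre of its expansion.\<close>

lemma eval_norm_le_radius:
  assumes f: "f \<in> int_series d" "fps_nth f 0 = 0"
    and h: "\<forall>i<d. vabs (h i) \<le> r" and r: "0 \<le> r" "r \<le> 1 / 2"
  shows "eval_norm h f \<le> r"
proof (rule LIMSEQ_le_const2)
  show "(\<lambda>n. vabs (trunc f h n)) \<longlonglongrightarrow> eval_norm h f"
    using h r by (intro eval_norm_lim[OF f(1)]) (force simp: small_def)
  have "vabs (trunc f h n) \<le> r" for n
    unfolding trunc_def
  proof (rule vabs_sum_le)
    fix j
    show "vabs (fps_nth f j h) \<le> r"
    proof (cases "j = 0")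
      case False
      have "vabs (fps_nth f j h) \<le> r ^ j"
        by (rule hom_fun_bound[OF int_series_nth[OF f(1)] h r(1)])
      also have "\<dots> \<le> r ^ 1"
        using False r by (intro power_decreasing) auto
      finally show ?thesis by simp
    qed (use f r in simp)
  qed (rule r)
  then show "\<exists>N. \<forall>n\<ge>N. vabs (trunc f h n) \<le> r" by blast
qed

text \<open>A summable family is bounded, so the expansion at the diagonal point
  \<open>(w, ..., w)\<close> bounds all \<open>c j \<alpha> * w ^ total_degree d \<alpha>\<close>; a
  further factor \<open>y\<close> makes the coefficients of positive degree integral. The constant
  term cannot be improved by scaling and is subtracted.\<close>

lemma locally_analytic_expansion:
  fixes u :: "(nat \<Rightarrow> 'k::nonarch_valued_field) \<Rightarrow> (nat \<Rightarrow> 'k)"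
  assumes nontriv: "\<exists>x::'k. x \<noteq> 0 \<and> vabs x \<noteq> 1"
    and u: "locally_analytic d l u" and a: "a \<in> Kpow d"
  obtains b F where "b \<noteq> 0" "\<And>j. F j \<in> int_series d" "\<And>j. fps_nth (F j) 0 = 0"
    "\<And>j h. j < l \<Longrightarrow> h \<in> Kpow d \<Longrightarrow> small d h \<Longrightarrow>
       eval_norm h (F j) = vabs (u (\<lambda>i. a i + b * h i) j - u a j)"
proof -
  obtain r c where r: "r > 0" and "\<forall>h\<in>Kpow d. (\<forall>i<d. vabs (h i) < r) \<longrightarrow>
      (\<forall>j<l. ((\<lambda>\<alpha>. c j \<alpha> * (\<Prod>i<d. h i ^ \<alpha> i)) has_sum u (\<lambda>i. a i + h i) j) (multi_indices d))"
    using bspec[OF conjunct2[OF u[unfolded locally_analytic_def]] a] by (elim exE conjE)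
  then have c: "((\<lambda>\<alpha>. c j \<alpha> * (\<Prod>i<d. h i ^ \<alpha> i)) has_sum u (\<lambda>i. a i + h i) j) (multi_indices d)"
    if "h \<in> Kpow d" "\<forall>i<d. vabs (h i) < r" "j < l" for h j
    using that by simp
  obtain w :: 'k where w: "w \<noteq> 0" "vabs w < r"
    using exists_small[OF nontriv r] by blast
  have "\<forall>j. \<exists>C\<ge>1. j < l \<longrightarrow> (\<forall>\<alpha>\<in>multi_indices d. vabs (c j \<alpha> * w ^ total_degree d \<alpha>) \<le> C)"
  proof
    fix j
    show "\<exists>C\<ge>1. j < l \<longrightarrow> (\<forall>\<alpha>\<in>multi_indices d. vabs (c j \<alpha> * w ^ total_degree d \<alpha>) \<le> C)"
    proof (cases "j < l")
      case True
      let ?h = "\<lambda>i. if i < d then w else 0"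
      have "((\<lambda>\<alpha>. c j \<alpha> * (\<Prod>i<d. ?h i ^ \<alpha> i)) has_sum u (\<lambda>i. a i + ?h i) j) (multi_indices d)"
        using True w(2) by (intro c) (auto simp: Kpow_def)
      then have "((\<lambda>\<alpha>. c j \<alpha> * w ^ total_degree d \<alpha>) has_sum u (\<lambda>i. a i + ?h i) j) (multi_indices d)"
        by (simp add: total_degree_def power_sum)
      then show ?thesis using has_sum_terms_bounded by blast
    qed auto
  qed
  then obtain C where "\<forall>j. 1 \<le> C j \<and> (j < l \<longrightarrow> (\<forall>\<alpha>\<in>multi_indices d. vabs (c j \<alpha> * w ^ total_degree d \<alpha>) \<le> C j))"
    by (rule choice[THEN exE])
  then have C: "1 \<le> C j" "j < l \<Longrightarrow> \<alpha> \<in> multi_indices d \<Longrightarrow> vabs (c j \<alpha> * w ^ total_degree d \<alpha>) \<le> C j" for j \<alpha>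
    by blast+
  define m where "m = Max (insert 1 (C ` {..<l}))"
  have "1 \<le> m" unfolding m_def by (intro Max_ge) auto
  have m: "C j \<le> m" if "j < l" for j unfolding m_def using that by (intro Max_ge) auto
  obtain y :: 'k where y: "y \<noteq> 0" "vabs y < 1 / m"
    using exists_small[OF nontriv, of "1 / m"] \<open>1 \<le> m\<close> by auto
  have ym: "vabs y * m \<le> 1" using y(2) \<open>1 \<le> m\<close> by (simp add: field_simps)
  have y1: "vabs y \<le> 1"
    using mult_left_mono[OF \<open>1 \<le> m\<close> vabs_nonneg[of y]] ym by simp
  define b where "b = w * y"
  have "b \<noteq> 0" using w y by (simp add: b_def)
  have b_less: "vabs b < r"
    using y1 w(2) mult_left_mono[OF y1 vabs_nonneg[of w]] by (simp add: b_def vabs_mult)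
  \<comment> \<open>Positive degree provides at least one factor \<open>vabs y\<close>, which
    outweighs the bound \<open>m\<close>.\<close>
  have coeff: "vabs (c j \<alpha> * b ^ total_degree d \<alpha>) \<le> 1"
    if "j < l" "\<alpha> \<in> multi_indices d" "total_degree d \<alpha> \<noteq> 0" for j \<alpha>
  proof -
    have "vabs (c j \<alpha> * b ^ total_degree d \<alpha>) = vabs (c j \<alpha> * w ^ total_degree d \<alpha>) * vabs y ^ total_degree d \<alpha>"
      by (simp add: b_def vabs_mult vabs_power power_mult_distrib)
    also have "\<dots> \<le> m * vabs y"
    proof (rule mult_mono)
      show "vabs (c j \<alpha> * w ^ total_degree d \<alpha>) \<le> m" using C(2)[OF that(1,2)] m[OF that(1)] by simp
      have "vabs y ^ total_degree d \<alpha> \<le> vabs y ^ 1"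
        using that(3) y1 by (intro power_decreasing) (auto simp: vabs_nonneg)
      then show "vabs y ^ total_degree d \<alpha> \<le> vabs y" by simp
    qed (use \<open>1 \<le> m\<close> in \<open>auto simp: vabs_nonneg\<close>)
    also have "\<dots> \<le> 1" using ym by (simp add: mult.commute)
    finally show ?thesis .
  qed
  let ?I = "\<lambda>n. {\<alpha> \<in> multi_indices d. total_degree d \<alpha> = n}"
  \<comment> \<open>Components from \<open>l\<close> on are set to 0, so that every
    \<open>F j\<close> is an integral series; the omitted part \<open>n = 0\<close> is the
    subtracted constant term.\<close>
  define F where "F j = Abs_fps (\<lambda>n h. if n = 0 \<or> l \<le> j then 0
      else \<Sum>\<alpha>\<in>?I n. (c j \<alpha> * b ^ n) * (\<Prod>i<d. h i ^ \<alpha> i))" for j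
  have F: "F j \<in> int_series d" for j
    unfolding int_series_def
  proof (intro CollectI allI)
    fix n
    show "hom_fun d n (fps_nth (F j) n)"
    proof (cases "n = 0 \<or> l \<le> j")
      case True
      then have "fps_nth (F j) n = (\<lambda>_. 0)" by (auto simp: F_def)
      then show ?thesis by (simp add: hom_fun_zero)
    next
      case False
      have "hom_fun d n (\<Sum>\<alpha>\<in>?I n. (\<lambda>h. (c j \<alpha> * b ^ n) * (\<Prod>i<d. h i ^ \<alpha> i)))"
      proof (rule hom_fun_sum)
        fix \<alpha> assume "\<alpha> \<in> ?I n"
        then show "hom_fun d n (\<lambda>h. (c j \<alpha> * b ^ n) * (\<Prod>i<d. h i ^ \<alpha> i))"
          using False coeff[of j \<alpha>] hom_fun_monomial[of d d \<alpha>] by (intro hom_fun_scale) auto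
      qed
      moreover have "fps_nth (F j) n = (\<Sum>\<alpha>\<in>?I n. (\<lambda>h. (c j \<alpha> * b ^ n) * (\<Prod>i<d. h i ^ \<alpha> i)))"
        using False by (auto simp: F_def sum_fun_apply fun_eq_iff)
      ultimately show ?thesis by simp
    qed
  qed
  have F0: "fps_nth (F j) 0 = 0" for j
    by (simp add: F_def zero_fun_def)
  have "eval_norm h (F j) = vabs (u (\<lambda>i. a i + b * h i) j - u a j)"
    if j: "j < l" and h: "h \<in> Kpow d" "small d h" for j h
  proof (rule eval_norm_eqI)
    define G where "G h n = (\<Sum>\<alpha>\<in>?I n. c j \<alpha> * (\<Prod>i<d. h i ^ \<alpha> i))" for h n
    have lim: "(\<lambda>n. \<Sum>k<n. G h k) \<longlonglongrightarrow> u (\<lambda>i. a i + h i) j" if "h \<in> Kpow d" "\<forall>i<d. vabs (h i) < r" for h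
      unfolding G_def by (rule has_sum_graded_partial_sums[OF c[OF that j]])
    have I0: "?I 0 = {\<lambda>_. 0}"
      using total_degree_eq_0 by (auto simp: multi_indices_def total_degree_def)
    have G0: "G h 0 = c j (\<lambda>_. 0)" for h
      by (simp add: G_def I0)
    \<comment> \<open>At \<open>h = 0\<close> only the constant monomial survives, which identifies
      the omitted term.\<close>
    have "c j (\<lambda>_. 0) = u a j"
    proof (rule LIMSEQ_unique)
      show "(\<lambda>n. \<Sum>k<n. G (\<lambda>_. 0) k) \<longlonglongrightarrow> u a j"
        using lim[of "\<lambda>_. 0"] r by (simp add: Kpow_def)
      have "G (\<lambda>_. 0) k = 0" if "k > 0" for k
      proof -
        have "\<exists>i<d. \<alpha> i \<noteq> 0" if "\<alpha> \<in> ?I k" for \<alpha>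
          using that \<open>k > 0\<close> by (metis (mono_tags, lifting) lessThan_iff less_irrefl mem_Collect_eq
              sum.neutral total_degree_def)
        then show ?thesis
          unfolding G_def by (intro sum.neutral ballI) (force simp: power_0_left)
      qed
      then have "(\<Sum>k<Suc n. G (\<lambda>_. 0) k) = c j (\<lambda>_. 0)" for n
        by (subst sum.lessThan_Suc_shift) (simp add: G0)
      then show "(\<lambda>n. \<Sum>k<n. G (\<lambda>_. 0) k) \<longlonglongrightarrow> c j (\<lambda>_. 0)"
        by (subst filterlim_sequentially_Suc[symmetric]) simp
    qed
    have "\<forall>i<d. vabs (b * h i) < r"
    proof (intro allI impI)
      fix i assume "i < d"
      then have "vabs (h i) \<le> 1" using h(2) by (force simp: small_def)
      then have "vabs b * vabs (h i) \<le> vabs b" by (simp add: mult_left_le vabs_nonneg)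
      then show "vabs (b * h i) < r" using b_less by (simp add: vabs_mult)
    qed
    then have "(\<lambda>n. \<Sum>k<n. G (\<lambda>i. b * h i) k) \<longlonglongrightarrow> u (\<lambda>i. a i + b * h i) j"
      using h(1) by (intro lim) (auto simp: Kpow_def)
    then have "(\<lambda>n. (\<Sum>k<Suc n. G (\<lambda>i. b * h i) k) - u a j) \<longlonglongrightarrow> u (\<lambda>i. a i + b * h i) j - u a j"
      by (intro tendsto_diff tendsto_const) (rule LIMSEQ_Suc)
    moreover have "(\<Sum>k<Suc n. G (\<lambda>i. b * h i) k) - u a j = trunc (F j) h (Suc n)" for n
    proof -
      have "G (\<lambda>i. b * h i) (Suc k) = fps_nth (F j) (Suc k) h" for k
      proof -
        have "(\<Prod>i<d. (b * h i) ^ \<alpha> i) = b ^ total_degree d \<alpha> * (\<Prod>i<d. h i ^ \<alpha> i)" for \<alpha>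
          by (simp add: power_mult_distrib prod.distrib total_degree_def power_sum)
        then show ?thesis
          using j by (auto simp: G_def F_def mult.assoc intro!: sum.cong)
      qed
      then show ?thesis
        unfolding trunc_def sum.lessThan_Suc_shift
        by (simp add: G0 F0 \<open>c j (\<lambda>_. 0) = u a j\<close>)
    qed
    ultimately have "(\<lambda>n. trunc (F j) h (Suc n)) \<longlonglongrightarrow> u (\<lambda>i. a i + b * h i) j - u a j"
      by simp
    then show "(\<lambda>n. trunc (F j) h n) \<longlonglongrightarrow> u (\<lambda>i. a i + b * h i) j - u a j"
      by (rule LIMSEQ_imp_Suc)
  qed
  then show ?thesis using that \<open>b \<noteq> 0\<close> F F0 by blast
qed

section \<open>The discontinuous function\<close>

definition spike_set :: "'k::nonarch_valued_field \<Rightarrow> nat \<Rightarrow> (nat \<Rightarrow> 'k) set" where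
  "spike_set p m = {x. \<exists>n\<ge>1. \<forall>j<m. vabs (x j) = vabs p ^ (n ^ Suc j)}"

text \<open>The set where a coordinate has a given nonzero absolute value is open and closed. A
  nonzero \<open>y i\<close> leaves at most one candidate \<open>n\<close> near \<open>y\<close>, so
  membership there is a finite conjunction of such conditions.\<close>

lemma spike_set_locally_constant:
  assumes p: "p \<noteq> 0" "vabs p < 1" and y: "i < m" "y i \<noteq> 0"
  shows "\<exists>e>0. \<forall>x. (\<forall>j<m. vabs (x j - y j) < e) \<longrightarrow> (x \<in> spike_set p m \<longleftrightarrow> y \<in> spike_set p m)"
proof -
  have inj: "n = n'" if "vabs p ^ (n ^ Suc i) = vabs p ^ (n' ^ Suc i)" for n n'
  proof -
    have "0 < vabs p" using p by (simp add: vabs_pos_iff)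
    then have "n ^ Suc i = n' ^ Suc i"
      using that p(2) power_strict_decreasing[of _ _ "vabs p"] by (metis linorder_neqE_nat less_irrefl)
    then show ?thesis by (metis power_eq_imp_eq_base zero_le zero_less_Suc)
  qed
  have pos: "0 < vabs p ^ k" for k using p by (simp add: vabs_pos_iff)
  have yi: "0 < vabs (y i)" using y by (simp add: vabs_pos_iff)
  show ?thesis
  proof (cases "\<exists>n\<ge>1. vabs (y i) = vabs p ^ (n ^ Suc i)")
    case False
    have "x \<notin> spike_set p m" if "vabs (x i) = vabs (y i)" for x
      using False y(1) that unfolding spike_set_def by fastforce
    moreover have "vabs (x i) = vabs (y i)" if "\<forall>j<m. vabs (x j - y j) < vabs (y i)" for x
      using that y(1) by (intro vabs_eq_of_near) blast
    ultimately have "(x \<in> spike_set p m) = (y \<in> spike_set p m)" if "\<forall>j<m. vabs (x j - y j) < vabs (y i)" for x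
      using that by blast
    then show ?thesis
      using yi by (intro exI[of _ "vabs (y i)"]) blast
  next
    case True
    then obtain n where n: "n \<ge> 1" "vabs (y i) = vabs p ^ (n ^ Suc i)" by blast
    have spike: "x \<in> spike_set p m \<longleftrightarrow> (\<forall>j<m. vabs (x j) = vabs p ^ (n ^ Suc j))"
      if "vabs (x i) = vabs (y i)" for x
    proof
      assume "x \<in> spike_set p m"
      then obtain k where k: "\<forall>j<m. vabs (x j) = vabs p ^ (k ^ Suc j)"
        unfolding spike_set_def by blast
      then have "k = n" using that n(2) y(1) by (intro inj) metis
      with k show "\<forall>j<m. vabs (x j) = vabs p ^ (n ^ Suc j)" by simp
    qed (use n in \<open>auto simp: spike_set_def\<close>)
    \<comment> \<open>If \<open>vabs (x j - y j)\<close> is below the target value, then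
      \<open>x j\<close> and \<open>y j\<close> either both have this absolute value or both lack
      it; the minimum of the targets serves all \<open>j < m\<close>.\<close>
    define e where "e = Min ((\<lambda>j. vabs p ^ (n ^ Suc j)) ` {..<m})"
    have e_le: "e \<le> vabs p ^ (n ^ Suc j)" if "j < m" for j
      unfolding e_def using that by (intro Min_le) auto
    have "e > 0"
      unfolding e_def using y(1) by (subst Min_gr_iff) (auto simp: pos simp del: power_Suc)
    moreover have "x \<in> spike_set p m \<longleftrightarrow> y \<in> spike_set p m" if x: "\<forall>j<m. vabs (x j - y j) < e" for x
    proof -
      have iff: "vabs (x j) = vabs p ^ (n ^ Suc j) \<longleftrightarrow> vabs (y j) = vabs p ^ (n ^ Suc j)" if "j < m" for j
      proof -
        have less: "vabs (x j - y j) < vabs p ^ (n ^ Suc j)"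
          using x that e_le[OF that] by force
        have "vabs (x j) = vabs p ^ (n ^ Suc j) \<Longrightarrow> vabs (y j) = vabs (x j)"
          using less vabs_minus[of "x j - y j"] by (intro vabs_eq_of_near) simp
        moreover have "vabs (y j) = vabs p ^ (n ^ Suc j) \<Longrightarrow> vabs (x j) = vabs (y j)"
          using less by (intro vabs_eq_of_near) simp
        ultimately show ?thesis by metis
      qed
      then have "vabs (x i) = vabs (y i)" using y(1) n(2) by metis
      then show ?thesis using spike[of x] spike[of y] iff by auto
    qed
    ultimately show ?thesis by blast
  qed
qed

lemma spike_set_not_continuous:
  fixes p :: "'k::nonarch_valued_field"
  assumes p: "p \<noteq> 0" "vabs p < 1" and "m > 0"
  shows "\<not> continuous_on (Kpow m) (\<lambda>x. if x \<in> spike_set p m then 1 else 0 :: 'k)"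
    (is "\<not> continuous_on _ ?f")
proof
  assume cont: "continuous_on (Kpow m) ?f"
  \<comment> \<open>The index is shifted so that the base \<open>Suc n\<close> of the exponents is
    at least 1; the exponents are at least \<open>Suc n\<close>, so every coordinate tends to
    0.\<close>
  define X :: "nat \<Rightarrow> nat \<Rightarrow> 'k" where "X n j = (if j < m then p ^ (Suc n ^ Suc j) else 0)" for n j
  have "(\<lambda>n. X n j) \<longlonglongrightarrow> 0" for j
  proof (rule metric_LIMSEQ_I)
    fix e :: real assume "0 < e"
    obtain N where N: "vabs p ^ N < e"
      using real_arch_pow_inv[OF \<open>0 < e\<close> p(2)] by blast
    have "dist (X n j) 0 < e" if "n \<ge> N" for n
    proof -
      have "N \<le> Suc n ^ Suc j" using that self_le_power[of "Suc n" "Suc j"] by linarith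
      then have "vabs p ^ (Suc n ^ Suc j) \<le> vabs p ^ N"
        using p by (intro power_decreasing) (auto simp: vabs_nonneg)
      then show ?thesis using N \<open>0 < e\<close> by (simp add: X_def dist_vabs vabs_power del: power_Suc)
    qed
    then show "\<exists>N. \<forall>n\<ge>N. dist (X n j) 0 < e" by blast
  qed
  then have "limitin (product_topology (\<lambda>_. euclidean) UNIV) X (\<lambda>_. 0) sequentially"
    unfolding limitin_componentwise by simp
  then have "X \<longlonglongrightarrow> (\<lambda>_. 0)"
    unfolding euclidean_product_topology by simp
  then have "(\<lambda>n. ?f (X n)) \<longlonglongrightarrow> ?f (\<lambda>_. 0)"
    by (rule continuous_on_tendsto_compose[OF cont]) (auto simp: Kpow_def X_def)
  moreover have "X n \<in> spike_set p m" for n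
    unfolding spike_set_def X_def by (auto simp: vabs_power simp del: power_Suc intro!: exI[of _ "Suc n"])
  moreover have "(\<lambda>_. 0) \<notin> spike_set p m"
    using p(1) \<open>m > 0\<close> by (auto simp: spike_set_def vabs_eq_0_iff)
  ultimately have "(\<lambda>n. 1) \<longlonglongrightarrow> (0::'k)" by simp
  then show False using LIMSEQ_unique[OF tendsto_const] zero_neq_one by metis
qed

text \<open>Where \<open>u a\<close> has a nonzero coordinate, continuity of \<open>u\<close>
  suffices. At a zero of \<open>u\<close>, a nearby point mapped into the spike set has a large
  \<open>n\<close>, and there the values of \<open>F 0, ..., F d\<close> are lacunary of an order
  that \<open>scales_bounded\<close> excludes.\<close>

lemma spike_set_compose_locally_constant:
  fixes u :: "(nat \<Rightarrow> 'k::nonarch_valued_field) \<Rightarrow> (nat \<Rightarrow> 'k)"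
  assumes inf: "infinite (UNIV :: 'k set)" and nontriv: "\<exists>x::'k. x \<noteq> 0 \<and> vabs x \<noteq> 1"
    and p: "p \<noteq> 0" "vabs p < 1" and u: "locally_analytic d (Suc d) u"
  shows "locally_constant_on (Kpow d) (\<lambda>x. u x \<in> spike_set p (Suc d))"
proof (rule locally_constant_on_Kpow)
  fix a :: "nat \<Rightarrow> 'k" assume a: "a \<in> Kpow d"
  obtain b F where b: "b \<noteq> 0" and F: "\<And>j. F j \<in> int_series d" "\<And>j. fps_nth (F j) 0 = 0"
    and uF: "\<And>j h. j < Suc d \<Longrightarrow> h \<in> Kpow d \<Longrightarrow> small d h \<Longrightarrow>
       eval_norm h (F j) = vabs (u (\<lambda>i. a i + b * h i) j - u a j)"
    using locally_analytic_expansion[OF nontriv u a] by blast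
  have b_pos: "0 < vabs b" using b by (simp add: vabs_pos_iff)
  have near: "\<exists>h. (\<forall>i<d. vabs (h i) \<le> r) \<and> (\<forall>j<Suc d. eval_norm h (F j) = vabs (u x j - u a j))"
    if x: "x \<in> Kpow d" "\<forall>i<d. vabs (x i - a i) < vabs b * r" and r: "r \<le> 1 / 2" for x r
  proof -
    define h where "h i = (x i - a i) / b" for i
    have h: "vabs (h i) \<le> r" if "i < d" for i
      using x(2) that b_pos by (simp add: h_def vabs_divide divide_le_eq mult.commute less_imp_le)
    have "small d h" using h r by (force simp: small_def)
    moreover have "h \<in> Kpow d" using x(1) a by (simp add: h_def Kpow_def)
    moreover have "(\<lambda>i. a i + b * h i) = x" using b by (simp add: h_def fun_eq_iff)
    ultimately show ?thesis using uF[of _ h] h by (intro exI[of _ h]) auto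
  qed
  show "\<exists>e>0. \<forall>x\<in>Kpow d. (\<forall>i<d. vabs (x i - a i) < e) \<longrightarrow>
      (u x \<in> spike_set p (Suc d)) = (u a \<in> spike_set p (Suc d))"
  proof (cases "\<exists>i<Suc d. u a i \<noteq> 0")
    case True
    then obtain e where e: "e > 0"
      "\<And>x. \<forall>j<Suc d. vabs (x j - u a j) < e \<Longrightarrow> (x \<in> spike_set p (Suc d)) = (u a \<in> spike_set p (Suc d))"
      using spike_set_locally_constant[OF p, of _ "Suc d" "u a"] by blast
    define r where "r = min (1 / 2) (e / 2)"
    have r: "0 < r" "r \<le> 1 / 2" "r < e" using e(1) by (auto simp: r_def)
    have "(u x \<in> spike_set p (Suc d)) = (u a \<in> spike_set p (Suc d))"
      if x: "x \<in> Kpow d" "\<forall>i<d. vabs (x i - a i) < vabs b * r" for x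
    proof (rule e(2), intro allI impI)
      fix j assume "j < Suc d"
      obtain h where h: "\<forall>i<d. vabs (h i) \<le> r" "\<forall>j<Suc d. eval_norm h (F j) = vabs (u x j - u a j)"
        using near[OF x r(2)] by blast
      have "eval_norm h (F j) \<le> r"
        using r by (intro eval_norm_le_radius[OF F h(1)]) auto
      then show "vabs (u x j - u a j) < e" using h(2) \<open>j < Suc d\<close> r(3) by simp
    qed
    then show ?thesis using r(1) b_pos by (intro exI[of _ "vabs b * r"]) auto
  next
    case False
    then have ua: "u a j = 0" if "j < Suc d" for j using that by blast
    have notin: "z \<notin> spike_set p (Suc d)" if "z d = 0" for z
      using that p(1) by (auto simp: spike_set_def vabs_eq_0_iff)
    obtain N where N: "F d \<noteq> 0 \<Longrightarrow> \<forall>i<d. vabs (h i) \<le> (1 / 2) ^ N \<Longrightarrow>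
        \<not> lacunary N d (\<lambda>j. eval_norm h (F j))" for h
      using scales_bounded[OF inf nontriv, where u = F and d = d] F(1) unfolding scales_bounded_def by blast
    \<comment> \<open>The bound \<open>vabs p ^ Suc N\<close> forces \<open>n > N\<close>, since the
      first coordinate of \<open>u x\<close> has absolute value \<open>vabs p ^ n\<close> and is at
      most \<open>r\<close>.\<close>
    define r where "r = min (1 / 2) (min ((1 / 2) ^ N) (vabs p ^ Suc N))"
    have r: "0 < r" "r \<le> 1 / 2" "r \<le> (1 / 2) ^ N" "r \<le> vabs p ^ Suc N"
      using p(1) by (auto simp: r_def vabs_pos_iff)
    have "u x \<notin> spike_set p (Suc d)"
      if x: "x \<in> Kpow d" "\<forall>i<d. vabs (x i - a i) < vabs b * r" for x
    proof
      assume spike: "u x \<in> spike_set p (Suc d)"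
      obtain h where h: "\<forall>i<d. vabs (h i) \<le> r" "\<And>j. j < Suc d \<Longrightarrow> eval_norm h (F j) = vabs (u x j)"
        using near[OF x r(2)] ua by auto
      obtain n where n: "n \<ge> 1" "\<And>j. j < Suc d \<Longrightarrow> vabs (u x j) = vabs p ^ (n ^ Suc j)"
        using spike unfolding spike_set_def by blast
      have t: "eval_norm h (F j) = vabs p ^ (n ^ Suc j)" if "j \<le> d" for j
        using h(2)[of j] n(2)[of j] that by simp
      have pos: "0 < vabs p" using p(1) by (simp add: vabs_pos_iff)
      \<comment> \<open>Otherwise the last coordinate of \<open>u x\<close> would vanish, while
        coordinates of points of the spike set are nonzero.\<close>
      have "F d \<noteq> 0"
        using t[of d] pos by (metis eval_norm_zero order_refl less_irrefl zero_less_power)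
      have "eval_norm h (F 0) \<le> r"
        using r by (intro eval_norm_le_radius[OF F h(1)]) auto
      then have p_n: "vabs p ^ n \<le> r" using t[of 0] by simp
      have "N < n"
      proof (rule ccontr)
        assume "\<not> N < n"
        then have "vabs p ^ Suc N < vabs p ^ n"
          using pos p(2) by (intro power_strict_decreasing) auto
        then show False using p_n r(4) by linarith
      qed
      have "lacunary N d (\<lambda>j. eval_norm h (F j))"
        unfolding lacunary_def
      proof (intro conjI allI impI)
        show "eval_norm h (F 0) \<le> (1 / 2) ^ N" using \<open>eval_norm h (F 0) \<le> r\<close> r(3) by linarith
        fix j assume "j < d"
        show "0 < eval_norm h (F j)" using t[of j] pos \<open>j < d\<close> by simp
        \<comment> \<open>Each size is exactly the \<open>n\<close>-th power of the one before, and
          \<open>N < n\<close>.\<close>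
        have "n ^ Suc j * N \<le> n ^ Suc (Suc j)"
          using \<open>N < n\<close> by simp
        then have "vabs p ^ (n ^ Suc (Suc j)) \<le> vabs p ^ (n ^ Suc j * N)"
          using pos p(2) by (intro power_decreasing) auto
        then show "eval_norm h (F (Suc j)) \<le> eval_norm h (F j) ^ N"
          using t[of j] t[of "Suc j"] \<open>j < d\<close> by (simp add: power_mult del: power_Suc)
      qed
      moreover have "\<forall>i<d. vabs (h i) \<le> (1 / 2) ^ N"
        using h(1) r(3) order_trans by blast
      ultimately show False using N[OF \<open>F d \<noteq> 0\<close>] by blast
    qed
    then show ?thesis
      using r(1) b_pos notin[of "u a"] ua[of d] by (intro exI[of _ "vabs b * r"]) auto
  qed
qed

theorem theorem42:
  fixes m :: nat
  assumes "infinite (UNIV :: 'k::nonarch_valued_field set)"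
    and "\<exists>x::'k. x \<noteq> 0 \<and> vabs x \<noteq> 1"
    and "m \<ge> 2"
  shows "\<exists>f :: (nat \<Rightarrow> 'k) \<Rightarrow> 'k.
    \<not> continuous_on (Kpow m) f \<and>
    (\<forall>u. locally_analytic (m - 1) m u \<longrightarrow> f \<circ> u \<in> C_infinity (m - 1))"
proof -
  obtain p :: 'k where p: "p \<noteq> 0" "vabs p < 1"
    using exists_small[OF assms(2), of 1] by auto
  define f :: "(nat \<Rightarrow> 'k) \<Rightarrow> 'k" where "f x = (if x \<in> spike_set p m then 1 else 0)" for x
  have "\<not> continuous_on (Kpow m) f"
    unfolding f_def using spike_set_not_continuous[OF p, of m] assms(3) by simp
  moreover have "f \<circ> u \<in> C_infinity (m - 1)" if "locally_analytic (m - 1) m u" for u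
  proof (rule locally_constant_imp_C_infinity)
    have m: "Suc (m - 1) = m" using assms(3) by simp
    have "locally_constant_on (Kpow (m - 1)) (\<lambda>x. u x \<in> spike_set p m)"
      using spike_set_compose_locally_constant[OF assms(1,2) p, of "m - 1" u] that unfolding m by blast
    from locally_constant_on_binary[OF this this, of "\<lambda>c _. if c then 1 else 0"]
    show "locally_constant_on (Kpow (m - 1)) (f \<circ> u)"
      by (simp add: f_def comp_def)
  qed
  ultimately show ?thesis by blast
qed

end
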